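(* Let $f:\mathbb{C}\to\mathbb{C}$ be a transcendental entire function and let $D$ be a tract of $f$ with bounded geometry with respect to harmonic measure. Then, given any positive sequence $(a_n)$ such that $a_n\to\infty$ as $n\to\infty$, there exist $$\zeta\in I(f)\cap J(f)\cap\overline{D}\quad\text{and}\quad N\in\mathbb{N}$$ such that $$f^n(\zeta)\in\overline{D}\quad\text{for all } n\geq 1,$$ and $$|f^n(\zeta)|\leq a_n\quad\text{for all } n\geq N.$$
   Context: $f^n$ denotes the $n$th iterate of $f$, and $\mathbb{N}$ denotes the non-negative integers. The Fatou set $F(f)$ is the subset of $\mathbb{C}$ where the iterates $(f^n)$ form a normal family, and the Julia set is $J(f)=\mathbb{C}\setminus F(f)$. The escaping set is $I(f)=\{z: f^n(z)\to\infty \text{ as } n\to\infty\}$. Direct tract: let $D$ be an unbounded domain in $\mathbb{C}$ whose boundary consists of piecewise smooth curves and whose complement is unbounded. Let $f$ be a complex valued function whose domain of definition contains the closure $\overline{D}$. Then $D$ is a direct tract of $f$ if $f$ is holomorphic in $D$, continuous in $\overline{D}$, and there exists $R>0$ such that $|f(z)|=R$ for $z\in\partial D$ while $|f(z)|>R$ for $z\in D$. "Tract" means direct tract. Bounded geometry with respect to harmonic measure: let $D$ be a direct tract of a function $f$, where $|f(z)|=1$ on $\partial D$, for which there exists a sequence $\Sigma_n$ of quadrilaterals in $D$ tending to $\infty$ (that is, $\inf\{|z|:z\in\Sigma_n\}\to\infty$ as $n\to\infty$), each of which contains a point $z_n$ such that $|f(z_n)|>\max\{|z|:z\in\Sigma_{n+1}\}$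 and such that the harmonic measure in $\Sigma_n$ at $z_n$ of some connected component $\sigma_n$ of $\partial\Sigma_n\cap\partial D$ is bounded from below by some positive value independent of $n$. Then $D$ is said to have bounded geometry with respect to harmonic measure. Here a quadrilateral is a bounded Jordan domain (with four distinguished boundary points). *)

theory Defs
  imports "HOL-Complex_Analysis.Complex_Analysis"
begin

definition transcendental_entire :: "(complex \<Rightarrow> complex) \<Rightarrow> bool" where
  "transcendental_entire f \<longleftrightarrow> f holomorphic_on UNIV \<and> \<not> (\<exists>p. \<forall>z. f z = poly p z)"

(* Normality with respect to the spherical metric: on a connected open set, a locally uniform
   spherical limit of holomorphic functions is either finite everywhere or identically infinity,
   so this notion is only meant to be used for holomorphic families on domains U. *)
definition normal_family :: "complex set \<Rightarrow> (complex \<Rightarrow> complex) set \<Rightarrow> bool" where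
  "normal_family U \<F> \<longleftrightarrow>
     (\<forall>g :: nat \<Rightarrow> complex \<Rightarrow> complex. range g \<subseteq> \<F> \<longrightarrow>
       (\<exists>r. strict_mono (r :: nat \<Rightarrow> nat) \<and>
         ((\<exists>h. \<forall>K. compact K \<and> K \<subseteq> U \<longrightarrow> uniform_limit K (g \<circ> r) h sequentially) \<or>
          (\<forall>K. compact K \<and> K \<subseteq> U \<longrightarrow>
            (\<forall>B. \<forall>\<^sub>F n in sequentially. \<forall>z\<in>K. norm (g (r n) z) > B)))))"

definition fatou_set :: "(complex \<Rightarrow> complex) \<Rightarrow> complex set" where
  "fatou_set f = {z. \<exists>U. open U \<and> connected U \<and> z \<in> U \<and> normal_family U (range (\<lambda>n. f ^^ n))}"

definition julia_set :: "(complex \<Rightarrow> complex) \<Rightarrow> complex set" where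
  "julia_set f = - fatou_set f"

definition escaping_set :: "(complex \<Rightarrow> complex) \<Rightarrow> complex set" where
  "escaping_set f = {z. filterlim (\<lambda>n. (f ^^ n) z) at_infinity sequentially}"

definition smooth_arc :: "(real \<Rightarrow> complex) \<Rightarrow> bool" where
  "smooth_arc \<gamma> \<longleftrightarrow> arc \<gamma> \<and> \<gamma> C1_differentiable_on {0..1} \<and>
     (\<forall>t\<in>{0..1}. vector_derivative \<gamma> (at t) \<noteq> 0)"

(* The curves may be unbounded and may have corners; cutting them into pieces yields a family of
   compact smooth arcs.  Local finiteness and regularity of the arcs are essential: every set is
   a union of constant curves. *)
definition consists_of_piecewise_smooth_curves :: "complex set \<Rightarrow> bool" where
  "consists_of_piecewise_smooth_curves B \<longleftrightarrow>
     (\<exists>\<Gamma>. (\<forall>\<gamma>\<in>\<Gamma>. smooth_arc \<gamma>) \<and>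
          B = (\<Union>\<gamma>\<in>\<Gamma>. path_image \<gamma>) \<and>
          (\<forall>K. compact K \<longrightarrow> finite {\<gamma>\<in>\<Gamma>. path_image \<gamma> \<inter> K \<noteq> {}}))"

definition direct_tract :: "(complex \<Rightarrow> complex) \<Rightarrow> complex set \<Rightarrow> bool" where
  "direct_tract f D \<longleftrightarrow>
     open D \<and> connected D \<and> \<not> bounded D \<and>
     consists_of_piecewise_smooth_curves (frontier D) \<and>
     \<not> bounded (- D) \<and>
     f holomorphic_on D \<and> continuous_on (closure D) f \<and>
     (\<exists>R>0. (\<forall>z\<in>frontier D. norm (f z) = R) \<and> (\<forall>z\<in>D. norm (f z) > R))"

definition jordan_domain :: "complex set \<Rightarrow> bool" where
  "jordan_domain S \<longleftrightarrow>
     (\<exists>\<gamma>. simple_path \<gamma> \<and> pathfinish \<gamma> = pathstart \<gamma> \<and> S = inside (path_image \<gamma>))"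

definition quadrilateral :: "complex set \<Rightarrow> complex set \<Rightarrow> bool" where
  "quadrilateral S V \<longleftrightarrow> jordan_domain S \<and> V \<subseteq> frontier S \<and> card V = 4"

definition subharmonic_on :: "(complex \<Rightarrow> real) \<Rightarrow> complex set \<Rightarrow> bool" where
  "subharmonic_on u S \<longleftrightarrow> continuous_on S u \<and>
     (\<forall>w r. r > 0 \<and> cball w r \<subseteq> S \<longrightarrow>
        u w \<le> 1 / (2 * pi) * integral {0..2 * pi} (\<lambda>t. u (w + of_real r * cis t)))"

(* The Perron solution of the Dirichlet problem in S whose boundary values are 1 on E and 0 on
   the rest of the frontier, evaluated at z.  For bounded S the constant 0 belongs to the Perron
   family and, by the maximum principle, all its members are at most 1. *)
definition harmonic_measure :: "complex set \<Rightarrow> complex set \<Rightarrow> complex \<Rightarrow> real" where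
  "harmonic_measure S E z =
     Sup {u z | u. subharmonic_on u S \<and>
       (\<forall>w\<in>frontier S. Limsup (at w within S) (\<lambda>x. ereal (u x)) \<le> ereal (indicator E w))}"

(* A quadrilateral is open, so the maximum of the modulus over it is read as a supremum. *)
definition bounded_geometry_harmonic_measure ::
    "(complex \<Rightarrow> complex) \<Rightarrow> complex set \<Rightarrow> bool" where
  "bounded_geometry_harmonic_measure f D \<longleftrightarrow>
     direct_tract f D \<and> (\<forall>z\<in>frontier D. norm (f z) = 1) \<and>
     (\<exists>(\<Sigma> :: nat \<Rightarrow> complex set) V z \<sigma>.
        (\<forall>n. quadrilateral (\<Sigma> n) (V n) \<and> \<Sigma> n \<subseteq> D) \<and>
        filterlim (\<lambda>n. INF w\<in>\<Sigma> n. norm w) at_top sequentially \<and>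
        (\<forall>n. z n \<in> \<Sigma> n \<and> norm (f (z n)) > (SUP w\<in>\<Sigma> (Suc n). norm w)) \<and>
        (\<forall>n. \<sigma> n \<in> components (frontier (\<Sigma> n) \<inter> frontier D)) \<and>
        (\<exists>c>0. \<forall>n. harmonic_measure (\<Sigma> n) (\<sigma> n) (z n) \<ge> c))"

end

theory Submission
  imports Defs
begin

text \<open>
  The idea is to show that, far out in the tract, the image of each quadrilateral covers a large
  annulus. If \<open>f\<close> omitted a value \<open>w\<close> on the quadrilateral \<open>\<Sigma>\<close>, a holomorphic logarithm \<open>F\<close> of \<open>f\<close>
  would map \<open>\<Sigma>\<close> into the right half plane and omit the vertical lattice of all logarithms of \<open>w\<close>. The
  boundary piece \<open>\<sigma>\<close>, at which \<open>Re F\<close> tends to 0, is connected, and \<open>\<Sigma>\<close> is simply connected; therefore a point with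
  \<open>Re F > ln (norm w)\<close> is cut off from \<open>\<sigma>\<close> by the preimage of a single gap of the lattice
  (\<open>omitted_lattice_separates\<close>). Such a gap has length \<open>2 * pi\<close>, which is tiny compared with its
  distance from the imaginary axis, so the harmonic measure of \<open>\<sigma>\<close> seen from beyond the lattice is
  small (\<open>harmonic_measure_small_if_value_omitted\<close>). Since the harmonic measure is bounded below,
  \<open>f ` \<Sigma>\<close> contains every \<open>w\<close> with \<open>R \<le> norm w \<le> norm (f z)\<close>, where \<open>R\<close> depends only on the bound
  (\<open>image_covers_annulus\<close>).

  Consequently the quadrilateral with index \<open>n\<close> covers the next one, and every other far-out
  quadrilateral that extends no further than the next one. There are infinitely many
  records, that is, quadrilaterals that extend no further than any later one; these cover themselves, so
  orbits can be held up there arbitrarily long, and later quadrilaterals cover them again. Orbits can thus be prescribed that pass to infinity through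
  the quadrilaterals as slowly as desired (\<open>slow_itinerary\<close>, \<open>orbit_through_compact_sets\<close>).

  To obtain a point of the Julia set, note that the closure of a quadrilateral at a record contains an
  escaping point as well as one with bounded orbit, while on a connected subset of the Fatou set either
  all points escape or none does (\<open>connected_fatou_subset_escaping\<close>). So these closures meet the Julia
  set, and the construction can be carried out inside it (\<open>slow_escaping_julia_point\<close>).
\<close>

section \<open>The maximum principle for subharmonic functions\<close>

text \<open>Cauchy's integral formula at the centre of the circle, in the parametrisation by \<open>{0..2*pi}\<close> in
which the sub-mean-value property of subharmonic functions is phrased.\<close>

lemma mean_value_holomorphic:
  assumes "G holomorphic_on cball w r" "r > 0"
  shows "((\<lambda>t. G (w + of_real r * cis t)) has_integral (2 * of_real pi * G w)) {0..2*pi}"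
proof -
  have "((\<lambda>u. G u / (u - w)) has_contour_integral (2 * of_real pi * \<i> * G w)) (circlepath w r)"
    by (rule Cauchy_integral_circlepath_simple) (use assms in auto)
  hence "((\<lambda>t. G (w + of_real r * cis t) / (w + of_real r * cis t - w) * of_real r * \<i> * cis t)
          has_integral (2 * of_real pi * \<i> * G w)) {0..2*pi}"
    unfolding circlepath_def
    by (subst (asm) has_contour_integral_part_circlepath_iff) auto
  hence "((\<lambda>t. \<i> * G (w + of_real r * cis t)) has_integral (2 * of_real pi * \<i> * G w)) {0..2*pi}"
    using assms(2) by (simp add: field_simps)
  hence "((\<lambda>t. (-\<i>) * (\<i> * G (w + of_real r * cis t))) has_integral ((-\<i>) * (2 * of_real pi * \<i> * G w))) {0..2*pi}"
    by (rule has_integral_mult_right)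
  moreover have "(-\<i>) * (\<i> * x) = x" for x :: complex by (simp flip: mult.assoc)
  moreover have "(-\<i>) * (2 * of_real pi * \<i> * G w) = 2 * of_real pi * G w" by simp
  ultimately show ?thesis by (simp only:)
qed

text \<open>The maximum principle, in the form used for every estimate below: a subharmonic function lies below
the real part of a holomorphic function on \<open>W\<close> as soon as it does so asymptotically at the frontier
of \<open>W\<close>. If it did not, the difference \<open>g\<close> would attain a positive maximum in \<open>W\<close>; on a small circle
around a maximum point the mean value forces \<open>g\<close> to be constant on that circle, so the set of maximum points could
not have a rightmost element, although it is compact.\<close>

lemma subharmonic_le_harmonic:
  assumes W: "open W" "bounded W" "W \<subseteq> S" and v: "subharmonic_on v S" and G: "G holomorphic_on W"
    and bdry: "\<And>\<xi> e. \<lbrakk>\<xi> \<in> frontier W; e > 0\<rbrakk> \<Longrightarrow> \<forall>\<^sub>F x in at \<xi> within W. v x < Re (G x) + e"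
    and x: "x \<in> W"
  shows "v x \<le> Re (G x)"
proof (rule ccontr)
  assume "\<not> v x \<le> Re (G x)"
  define g where "g = (\<lambda>y. v y - Re (G y))"
  have gx: "g x > 0" using \<open>\<not> _\<close> by (simp add: g_def)
  have cv: "continuous_on W v"
    using v W(3) by (auto simp: subharmonic_on_def intro: continuous_on_subset)
  have cg: "continuous_on W g"
    unfolding g_def using G by (intro continuous_intros cv holomorphic_on_imp_continuous_on)
  define K where "K = {y \<in> W. g y \<ge> g x}"
  \<comment> \<open>Superlevel sets of a positive level cannot accumulate at the frontier, where \<open>g\<close> is
      asymptotically at most 0.\<close>
  have "closed K"
    unfolding closed_sequential_limits
  proof (intro allI impI, elim conjE)
    fix s l assume s: "\<forall>n. s n \<in> K" and lim: "s \<longlonglongrightarrow> l"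
    have sW: "s n \<in> W" "g (s n) \<ge> g x" for n using s by (auto simp: K_def)
    have lcl: "l \<in> closure W"
      unfolding closure_sequential using sW(1) lim by (intro exI[of _ s]) simp
    have "l \<in> W"
    proof (rule ccontr)
      assume "l \<notin> W"
      hence "l \<in> frontier W" using lcl W(1) by (simp add: frontier_def interior_open)
      hence "\<forall>\<^sub>F y in at l within W. g y < g x" 
        using bdry[of l "g x"] gx by (simp add: g_def algebra_simps)
      moreover have "filterlim s (at l within W) sequentially"
        unfolding filterlim_at using lim sW \<open>l \<notin> W\<close> by (auto intro!: always_eventually)
      ultimately have "\<forall>\<^sub>F n in sequentially. g (s n) < g x"
        by (rule eventually_compose_filterlim)
      from eventually_happens'[OF sequentially_bot this] obtain n where "g (s n) < g x" ..
      with sW(2)[of n] show False by linarith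
    qed
    moreover have "(\<lambda>n. g (s n)) \<longlonglongrightarrow> g l"
      by (rule isCont_tendsto_compose[OF _ lim])
        (use cg W(1) \<open>l \<in> W\<close> in \<open>simp add: continuous_on_eq_continuous_at\<close>)
    hence "g l \<ge> g x"
      by (rule LIMSEQ_le_const) (use sW in auto)
    ultimately show "l \<in> K" by (simp add: K_def)
  qed
  moreover have "bounded K" using W(2) by (rule bounded_subset) (auto simp: K_def)
  ultimately have "compact K" by (simp add: compact_eq_bounded_closed)
  have KW: "K \<subseteq> W" by (auto simp: K_def)
  have "K \<noteq> {}" using x by (auto simp: K_def)
  then obtain y where y: "y \<in> K" "\<And>z. z \<in> K \<Longrightarrow> g z \<le> g y"
    using continuous_attains_sup[OF \<open>compact K\<close> _ continuous_on_subset[OF cg KW]] by metis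
  have max: "g z \<le> g y" if "z \<in> W" for z
  proof (cases "g z \<ge> g x")
    case True
    thus ?thesis using y(2) that by (simp add: K_def)
  next
    case False
    thus ?thesis using y(1) by (simp add: K_def)
  qed
  define X where "X = {z \<in> K. g z = g y}"
  have "compact X"
  proof -
    have "closedin (top_of_set K) X"
      unfolding X_def
      by (rule continuous_closedin_preimage_constant[OF continuous_on_subset[OF cg KW]])
    thus ?thesis using \<open>compact K\<close> closedin_compact by blast
  qed
  obtain w where w: "w \<in> X" "\<And>z. z \<in> X \<Longrightarrow> Re z \<le> Re w"
  proof -
    have "X \<noteq> {}" using y(1) by (auto simp: X_def)
    moreover have "continuous_on X Re" by (intro continuous_intros)
    ultimately show thesis
      using continuous_attains_sup[OF \<open>compact X\<close>, of Re] that by blast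
  qed
  have wW: "w \<in> W" and gw: "g w = g y" using w(1) by (auto simp: X_def K_def)
  obtain r where r: "r > 0" "cball w r \<subseteq> W"
    using W(1) wW open_contains_cball by blast
  have circ: "w + of_real r * cis t \<in> W" for t
    using r by (auto simp: dist_norm norm_mult intro!: subsetD[OF r(2)])
  have ccirc: "continuous_on {0..2*pi} (\<lambda>t. h (w + of_real r * cis t))" 
    if "continuous_on W h" for h :: "complex \<Rightarrow> real"
    by (rule continuous_on_compose2[OF that]) (auto intro!: continuous_intros circ)
  define I where "I = integral {0..2*pi} (\<lambda>t. g (w + of_real r * cis t))"
  have "v w \<le> 1 / (2*pi) * integral {0..2*pi} (\<lambda>t. v (w + of_real r * cis t))"
    using v r W(3) unfolding subharmonic_on_def by blast
  moreover have "((\<lambda>t. Re (G (w + of_real r * cis t))) has_integral Re (2 * of_real pi * G w)) {0..2*pi}"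
    using mean_value_holomorphic[of G w r] G r holomorphic_on_subset
    by (intro has_integral_Re) auto
  moreover have "(\<lambda>t. v (w + of_real r * cis t)) integrable_on {0..2*pi}"
    by (intro integrable_continuous_real ccirc cv)
  ultimately have I: "2 * pi * g w \<le> I"
    unfolding I_def g_def 
    by (subst integral_diff) (auto simp: has_integral_iff field_simps)
  have "((\<lambda>t. g w - g (w + of_real r * cis t)) has_integral (2 * pi * g w - I)) {0..2*pi}"
    unfolding I_def
    by (intro has_integral_diff integrable_integral integrable_continuous_real ccirc cg)
       (use has_integral_const_real[of "g w" 0 "2*pi"] in simp)
  moreover have nn: "g w - g (w + of_real r * cis t) \<ge> 0" for t
    using max[OF circ] gw by simp
  ultimately have "((\<lambda>t. g w - g (w + of_real r * cis t)) has_integral 0) {0..2*pi}"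
    using I has_integral_nonneg[of _ "2 * pi * g w - I" "{0..2*pi}"] by (smt (verit))
  hence "((\<lambda>t. g w - g (w + of_real r * cis t)) has_integral 0) (cbox 0 (2*pi))" by simp
  hence "g w - g (w + of_real r * cis 0) = 0"
    by (rule has_integral_0_cbox_imp_0[rotated 2])
       (use nn pi_gt_zero in \<open>auto simp del: pi_gt_zero intro!: continuous_on_diff continuous_on_const ccirc cg\<close>)
  \<comment> \<open>The point of the circle at angle 0 is a maximum point to the right of \<open>w\<close>.\<close>
  hence "w + of_real r \<in> X"
    using circ[of 0] gw y by (auto simp: X_def K_def)
  from w(2)[OF this] r(1) show False by simp
qed

section \<open>Jordan domains near their boundary\<close>

lemma jordan_domainD:
  assumes "jordan_domain S"
  shows "open S" "connected S" "bounded S" "simply_connected S"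
  using assms Jordan_inside_outside simply_connected_inside_simple_path
  by (auto simp: jordan_domain_def)

text \<open>A boundary point of a Jordan domain has small neighbourhoods whose trace on the domain cannot be
split by a slightly larger disc. Remove from the curve a short arc around \<open>\<zeta>\<close> that lies in
\<open>ball \<zeta> e\<close>; the rest \<open>A\<close> is a connected compact set that avoids \<open>\<zeta>\<close>. Two points of the domain close
to \<open>\<zeta>\<close> are separated neither by the curve nor by \<open>A \<union> sphere \<zeta> e\<close>, and these two sets meet
exactly in the connected set \<open>A\<close>, so by Janiszewski's theorem their union does not separate the two
points either.\<close>

lemma Jordan_locally_connected_at_boundary:
  fixes g :: "real \<Rightarrow> complex"
  assumes "simple_path g" "pathfinish g = pathstart g" "\<zeta> \<in> path_image g" "e > 0"
  obtains d where "d > 0" "\<And>x y. \<lbrakk>x \<in> inside (path_image g) \<inter> ball \<zeta> d; y \<in> inside (path_image g) \<inter> ball \<zeta> d\<rbrakk>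
       \<Longrightarrow> connected_component (inside (path_image g) \<inter> ball \<zeta> e) x y"
proof -
  obtain a where a: "a \<in> {0..1}" "\<zeta> = g a" using assms(3) by (auto simp: path_image_def)
  \<comment> \<open>Reparametrise the curve so that it starts and ends at \<open>\<zeta>\<close>.\<close>
  define h where "h = shiftpath a g"
  have h: "simple_path h" "h 0 = \<zeta>" "h 1 = \<zeta>" "path_image h = path_image g"
    unfolding h_def using a assms 
      pathstart_shiftpath[of a g] pathfinish_shiftpath[of a g]
    by (auto simp: simple_path_shiftpath path_image_shiftpath pathstart_def pathfinish_def)
  have ch: "continuous_on {0..1} h" using h(1) by (simp add: simple_path_def path_def)
  have near: "\<exists>s>0. \<forall>t\<in>{0..1}. \<bar>t - c\<bar> < s \<longrightarrow> h t \<in> ball \<zeta> e" if "c = 0 \<or> c = 1" for c :: real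
    using ch[unfolded continuous_on_iff, rule_format, of c e] that h(2,3) assms(4)
    by (auto simp: dist_commute dist_real_def)
  obtain s0 s1 where s: "s0 > 0" "s1 > 0"
     "\<And>t. t \<in> {0..1} \<Longrightarrow> \<bar>t - 0\<bar> < s0 \<Longrightarrow> h t \<in> ball \<zeta> e"
     "\<And>t. t \<in> {0..1} \<Longrightarrow> \<bar>t - 1\<bar> < s1 \<Longrightarrow> h t \<in> ball \<zeta> e"
    using near[of 0] near[of 1] by blast
  define s where "s = min (min s0 s1) (1/2) / 2"
  have s': "0 < s" "s < s0" "s < s1" "s < 1/2" using s(1,2) by (auto simp: s_def)
  define A where "A = h ` {s..1-s}"
  have "compact A" unfolding A_def
    using s' by (intro compact_continuous_image continuous_on_subset[OF ch]) auto
  have "connected A" unfolding A_def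
    using s' by (intro connected_continuous_image continuous_on_subset[OF ch]) auto
  have "\<zeta> \<notin> A"
  proof
    assume "\<zeta> \<in> A"
    then obtain t where t: "s \<le> t" "t \<le> 1 - s" "h t = h 0" by (auto simp: A_def h(2))
    moreover have "t \<in> {0..1}" "(0::real) \<in> {0..1}" using t s' by auto
    ultimately have "t = 0 \<or> t = 1"
      using h(1) unfolding simple_path_def loop_free_def by blast
    thus False using t s' by auto
  qed
  have AS: "A \<subseteq> path_image g" unfolding A_def h(4)[symmetric] unfolding path_image_def using s' by auto
  have rest: "path_image g \<subseteq> A \<union> ball \<zeta> e"
  proof
    fix x assume "x \<in> path_image g"
    then obtain t where t: "t \<in> {0..1}" "x = h t"
      unfolding h(4)[symmetric] unfolding path_image_def by blast
    show "x \<in> A \<union> ball \<zeta> e"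
      using s(3)[OF t(1)] s(4)[OF t(1)] s' t by (cases "t < s"; cases "t > 1 - s") (auto simp: A_def)
  qed
  obtain d0 where d0: "d0 > 0" "ball \<zeta> d0 \<subseteq> - A"
    using \<open>compact A\<close> \<open>\<zeta> \<notin> A\<close> by (meson ComplI compact_imp_closed open_Compl open_contains_ball)
  define d where "d = min d0 e"
  note J = Jordan_inside_outside[OF assms(1,2)]
  have Jc: "connected (inside (path_image g))" "open (inside (path_image g))"
    and Jf: "frontier (inside (path_image g)) = path_image g"
    and Jn: "inside (path_image g) \<subseteq> - path_image g"
    using J inside_no_overlap[of "path_image g"] by blast+
  let ?S = "path_image g" and ?T = "A \<union> sphere \<zeta> e"
  show ?thesis
  proof (rule that[of d])
    show "d > 0" using d0 assms(4) by (simp add: d_def)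
    fix x y assume x: "x \<in> inside ?S \<inter> ball \<zeta> d" and y: "y \<in> inside ?S \<inter> ball \<zeta> d"
    have "connected_component (- (?S \<union> ?T)) x y"
    proof (rule Janiszewski)
      show "compact ?S" using assms(1) by (simp add: compact_simple_path_image)
      show "closed ?T" using \<open>compact A\<close> by (simp add: closed_Un compact_imp_closed)
      have "?S \<inter> ?T = A" using AS rest by (auto simp: dist_norm)
      thus "connected (?S \<inter> ?T)" using \<open>connected A\<close> by simp
      show "connected_component (- ?S) x y"
        by (rule connected_componentI[of "inside ?S"]) (use Jc Jn x y in auto)
      show "connected_component (- ?T) x y"
        by (rule connected_componentI[of "ball \<zeta> d"]) (use d0 x y in \<open>auto simp: d_def\<close>)
    qed
    then obtain C where C: "connected C" "C \<subseteq> - (?S \<union> ?T)" "x \<in> C" "y \<in> C"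
      unfolding connected_component_def by blast
    have "C \<subseteq> inside ?S"
      using connected_Int_frontier[OF C(1), of "inside ?S"] Jf C x by blast
    moreover have "C \<subseteq> ball \<zeta> e"
    proof (rule ccontr)
      assume "\<not> C \<subseteq> ball \<zeta> e"
      moreover have "x \<in> C \<inter> ball \<zeta> e" using C(3) x by (auto simp: d_def)
      ultimately have "C \<inter> frontier (ball \<zeta> e) \<noteq> {}"
        by (intro connected_Int_frontier C(1)) auto
      thus False using C(2) assms(4) by auto
    qed
    ultimately show "connected_component (inside ?S \<inter> ball \<zeta> e) x y"
      by (intro connected_componentI[OF C(1)]) (use C in auto)
  qed
qed

text \<open>The local statement is spread along \<open>\<sigma>\<close> by connectedness. The set \<open>V\<close> is to be thought of as the part
of \<open>S\<close> where some function that vanishes on \<open>\<sigma>\<close> is small: although \<open>V\<close> may have many components, all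
points of \<open>S\<close> near \<open>\<sigma>\<close> lie in a single one. This is where connectedness of \<open>\<sigma>\<close> enters; for a
fragmented boundary set of the same harmonic measure the covering theorem below can fail.\<close>

lemma connected_boundary_set_adjoins_one_component:
  assumes "jordan_domain S" "connected \<sigma>" "\<sigma> \<noteq> {}" "\<sigma> \<subseteq> frontier S"
    and nbd: "\<And>\<zeta>. \<zeta> \<in> \<sigma> \<Longrightarrow> \<exists>e>0. S \<inter> ball \<zeta> e \<subseteq> V"
  obtains x0 where "x0 \<in> V" "x0 \<in> S" "\<And>\<zeta>. \<zeta> \<in> \<sigma> \<Longrightarrow> \<exists>d>0. \<forall>x\<in>S \<inter> ball \<zeta> d. connected_component V x0 x"
proof -
  obtain g where g: "simple_path g" "pathfinish g = pathstart g" and S: "S = inside (path_image g)"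
    using assms(1) by (auto simp: jordan_domain_def)
  have fr: "frontier S = path_image g" using Jordan_inside_outside[OF g] S by simp
  have "\<exists>d>0. \<forall>x\<in>S \<inter> ball \<zeta> d. \<forall>y\<in>S \<inter> ball \<zeta> d. connected_component V x y" if \<zeta>: "\<zeta> \<in> \<sigma>" for \<zeta>
  proof -
    obtain e where e: "e > 0" "S \<inter> ball \<zeta> e \<subseteq> V" using nbd[OF \<zeta>] by blast
    have "\<zeta> \<in> path_image g" using \<zeta> assms(4) fr by blast
    from Jordan_locally_connected_at_boundary[OF g this e(1)] obtain d where
      "d > 0" "\<And>x y. \<lbrakk>x \<in> S \<inter> ball \<zeta> d; y \<in> S \<inter> ball \<zeta> d\<rbrakk> \<Longrightarrow> connected_component (S \<inter> ball \<zeta> e) x y"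
      unfolding S by metis
    thus ?thesis using connected_component_of_subset[OF _ e(2)] by blast
  qed
  then obtain d where d: "\<And>\<zeta>. \<zeta> \<in> \<sigma> \<Longrightarrow> d \<zeta> > 0"
    "\<And>\<zeta> x y. \<lbrakk>\<zeta> \<in> \<sigma>; x \<in> S \<inter> ball \<zeta> (d \<zeta>); y \<in> S \<inter> ball \<zeta> (d \<zeta>)\<rbrakk> \<Longrightarrow> connected_component V x y"
    by metis
  have meets: "\<exists>x. x \<in> S \<inter> ball \<zeta> r" if "\<zeta> \<in> \<sigma>" "r > 0" for \<zeta> r
  proof -
    have "\<zeta> \<in> closure S" using that(1) assms(4) by (auto simp: frontier_def)
    thus ?thesis using that(2) by (auto simp: closure_approachable dist_commute)
  qed
  obtain \<zeta>0 where z0: "\<zeta>0 \<in> \<sigma>" using assms(3) by blast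
  obtain x0 where x0: "x0 \<in> S \<inter> ball \<zeta>0 (d \<zeta>0)" using meets[OF z0 d(1)[OF z0]] by blast
  define P where "P = (\<lambda>\<zeta>. \<exists>r>0. \<forall>x\<in>S \<inter> ball \<zeta> r. connected_component V x0 x)"
  have P0: "P \<zeta>0" unfolding P_def using d(1)[OF z0] d(2)[OF z0 x0] by blast
  have "P \<zeta>" if "\<zeta> \<in> \<sigma>" for \<zeta>
  proof (rule connected_induction_simple[where P = P, OF assms(2) z0 that P0])
    fix \<xi> assume \<xi>: "\<xi> \<in> \<sigma>"
    show "\<exists>T. openin (top_of_set \<sigma>) T \<and> \<xi> \<in> T \<and> (\<forall>x\<in>T. \<forall>y\<in>T. P x \<longrightarrow> P y)"
    proof (intro exI[of _ "\<sigma> \<inter> ball \<xi> (d \<xi>)"] conjI ballI impI)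
      show "openin (top_of_set \<sigma>) (\<sigma> \<inter> ball \<xi> (d \<xi>))" by (simp add: openin_open_Int)
      show "\<xi> \<in> \<sigma> \<inter> ball \<xi> (d \<xi>)" using \<xi> d(1) by simp
      fix a b assume a: "a \<in> \<sigma> \<inter> ball \<xi> (d \<xi>)" and b: "b \<in> \<sigma> \<inter> ball \<xi> (d \<xi>)" and "P a"
      then obtain r where r: "r > 0" "\<And>x. x\<in>S \<inter> ball a r \<Longrightarrow> connected_component V x0 x"
        by (auto simp: P_def)
      obtain r' where r': "r' > 0" "ball a r' \<subseteq> ball \<xi> (d \<xi>)"
        using a open_contains_ball[of "ball \<xi> (d \<xi>)"] by blast
      obtain x where x: "x \<in> S \<inter> ball a (min r r')" using meets[of a "min r r'"] a r(1) r'(1) by auto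
      obtain q where q: "q > 0" "ball b q \<subseteq> ball \<xi> (d \<xi>)"
        using b open_contains_ball[of "ball \<xi> (d \<xi>)"] by blast
      show "P b" unfolding P_def
      proof (intro exI[of _ q] conjI ballI q(1))
        fix y assume "y \<in> S \<inter> ball b q"
        hence "connected_component V x y" using x r' q by (intro d(2)[OF \<xi>]) auto
        moreover have "connected_component V x0 x" using x r by auto
        ultimately show "connected_component V x0 y" using connected_component_trans by blast
      qed
    qed
  qed
  moreover have "x0 \<in> V" using d(2)[OF z0 x0 x0] connected_component_in by blast
  ultimately show ?thesis using that x0 unfolding P_def by blast
qed

section \<open>Separation by an omitted lattice\<close>

text \<open>Two continuous logarithms of the same function along a connected set have the same increments. The
constant \<open>c\<close> selects the branch cut: it rotates the values of \<open>g\<close> into the slit plane.\<close>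

lemma log_increment:
  fixes h g :: "'a :: topological_space \<Rightarrow> complex"
  assumes "connected T" "continuous_on T h" "continuous_on T g"
    and eh: "\<And>x. x \<in> T \<Longrightarrow> exp (h x) = g x"
    and c: "c \<noteq> 0" "\<And>x. x \<in> T \<Longrightarrow> c * g x \<notin> \<real>\<^sub>\<le>\<^sub>0" and xy: "x \<in> T" "y \<in> T"
  shows "h x - h y = Ln (c * g x) - Ln (c * g y)"
proof -
  define D where "D = (\<lambda>x. h x - Ln (c * g x))"
  have eD: "exp (D x) = 1 / c" if "x \<in> T" for x
  proof -
    have "g x \<noteq> 0" using eh[OF that] by (metis exp_not_eq_zero)
    thus ?thesis using eh[OF that] c(1) by (simp add: D_def exp_diff)
  qed
  have "D constant_on T"
  proof (rule continuous_discrete_range_constant[OF assms(1)])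
    show "continuous_on T D" unfolding D_def
      by (intro continuous_intros assms(2,3) c(2))
    fix x assume x: "x \<in> T"
    show "\<exists>e>0. \<forall>y. y \<in> T \<and> D y \<noteq> D x \<longrightarrow> e \<le> norm (D y - D x)"
    proof (intro exI[of _ "1::real"] conjI allI impI; (elim conjE)?)
      fix y assume y: "y \<in> T" "D y \<noteq> D x"
      have "exp (D y) = exp (D x)" using eD x y by simp
      then obtain n :: int where n: "D y = D x + of_real (2 * n * pi) * \<i>"
        by (auto simp: exp_eq)
      hence "n \<noteq> 0" using y(2) by auto
      hence "1 \<le> \<bar>real_of_int n\<bar>" by linarith
      moreover have "norm (D y - D x) = \<bar>real_of_int n\<bar> * (2 * pi)"
        using n by (simp add: norm_mult abs_mult)
      ultimately show "1 \<le> norm (D y - D x)" 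
        using pi_gt3 mult_mono[of 1 "\<bar>real_of_int n\<bar>" 1 "2*pi"] by simp
    qed simp
  qed
  hence "D x = D y" using xy by (auto simp: constant_on_def)
  thus ?thesis by (simp add: D_def algebra_simps)
qed

lemma Ln_divide_right_half_plane:
  assumes "Re a > 0" "Re b > 0"
  shows "Ln (a / b) = Ln a - Ln b"
proof (rule Ln_unique)
  have "a \<noteq> 0" "b \<noteq> 0" using assms by auto
  thus "exp (Ln a - Ln b) = a / b" by (simp add: exp_diff)
qed (use Re_Ln_pos_lt_imp[OF assms(1)] Re_Ln_pos_lt_imp[OF assms(2)] in auto)

text \<open>Passing to the upper or the lower half plane changes the principal logarithm by opposite constants;
this discrepancy is what produces the contradiction in the separation lemma below.\<close>

lemma Ln_rotate_right_half_plane: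
  assumes "Re a > 0"
  shows "Ln (\<i> * a) = Ln a + \<i> * (pi/2)" "Ln (- (\<i> * a)) = Ln a - \<i> * (pi/2)"
proof -
  have "a \<noteq> 0" using assms by auto
  have e: "exp (\<i> * (of_real pi/2)) = \<i>" using exp_Ln[of \<i>] by (simp add: mult.commute)
  show "Ln (\<i> * a) = Ln a + \<i> * (pi/2)"
    using Re_Ln_pos_lt_imp[OF assms] \<open>a \<noteq> 0\<close> e by (intro Ln_unique) (auto simp: exp_add)
  show "Ln (- (\<i> * a)) = Ln a - \<i> * (pi/2)"
  proof (rule Ln_unique)
    have "exp (Ln a - \<i> * (pi/2)) = a / \<i>" using \<open>a \<noteq> 0\<close> e by (simp add: exp_diff)
    thus "exp (Ln a - \<i> * (pi/2)) = - (\<i> * a)" by (simp add: field_simps)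
  qed (use Re_Ln_pos_lt_imp[OF assms] in auto)
qed

lemma quotient_nonpos_imp_in_segment:
  fixes w A B :: complex
  assumes "w \<noteq> B" "(w - A) / (w - B) \<in> \<real>\<^sub>\<le>\<^sub>0"
  shows "w \<in> closed_segment A B"
proof -
  obtain s where s: "s \<ge> 0" "(w - A) / (w - B) = - of_real s"
    using assms(2) by (auto elim!: nonpos_Reals_cases intro: that[of "- _"])
  hence "w - A = - of_real s * (w - B)" using assms(1) by (simp add: field_simps)
  hence "w * (1 + of_real s) = A + of_real s * B" by (simp add: algebra_simps)
  moreover have "(1 + of_real s :: complex) \<noteq> 0" using s(1)
    by (metis add_increasing of_real_1 of_real_add of_real_eq_0_iff less_numeral_extra(1) not_less add_pos_nonneg less_irrefl)
  ultimately have "w = (A + of_real s * B) / (1 + of_real s)" by (simp add: field_simps)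
  also have "\<dots> = (1 - s / (1 + s)) *\<^sub>R A + (s / (1 + s)) *\<^sub>R B"
  proof -
    have "1 - s / (1 + s) = 1 / (1 + s)" using s(1) by (simp add: field_simps)
    thus ?thesis by (simp add: scaleR_conv_of_real add_divide_distrib)
  qed
  finally show ?thesis unfolding in_segment using s(1)
    by (intro exI[of _ "s / (1 + s)"]) auto
qed

text \<open>The topological heart of the proof. The function \<open>F\<close> omits the points \<open>W k\<close> of a vertical lattice, whose
consecutive points bound gaps through which \<open>F\<close> must pass to get from one side of the line
\<open>Re w = Re w0\<close> to the other. Since \<open>S\<close> is simply connected, some single gap already blocks every path
from \<open>x0\<close> to \<open>z\<close>.

Indeed \<open>F - W k\<close> has a holomorphic logarithm \<open>l k\<close>. Let \<open>\<kappa> k\<close> compare its increment from \<open>x0\<close> to \<open>z\<close>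
with that of the principal logarithms on the two half planes; it records on which side of \<open>W k\<close> a
path passes. If \<open>x0\<close> and \<open>z\<close> can be joined avoiding the gap between \<open>W k\<close> and \<open>W (k+1)\<close>, then a
logarithm of \<open>(F - W k) / (F - W (k+1))\<close> along such a path shows that \<open>\<kappa> k = \<kappa> (k+1)\<close>. But along a
fixed path \<open>Im F\<close> is bounded, so \<open>\<kappa>\<close> equals \<open>\<i> * pi\<close> far up and \<open>- (\<i> * pi)\<close> far down the lattice.\<close>

lemma omitted_lattice_separates:
  fixes F :: "complex \<Rightarrow> complex" and w0 :: complex
  defines "W \<equiv> \<lambda>k::int. w0 + 2 * of_real pi * \<i> * of_int k"
  assumes S: "open S" "connected S" "simply_connected S" and F: "F holomorphic_on S"
    and omit: "\<And>k x. x \<in> S \<Longrightarrow> F x \<noteq> W k"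
    and x0: "x0 \<in> S" "Re (F x0) < Re w0" and z: "z \<in> S" "Re (F z) > Re w0"
  obtains k where "\<not> connected_component {x\<in>S. F x \<notin> closed_segment (W k) (W (k+1))} x0 z"
proof -
  have ReW: "Re (W k) = Re w0" and ImW: "Im (W k) = Im w0 + 2 * pi * k" for k by (auto simp: W_def)
  have cF: "continuous_on S F" by (rule holomorphic_on_imp_continuous_on[OF F])
  have "\<exists>l. l holomorphic_on S \<and> (\<forall>x\<in>S. exp (l x) = F x - W k)" for k
  proof -
    have "(\<lambda>x. F x - W k) holomorphic_on S" by (intro holomorphic_intros F)
    then obtain g where "g holomorphic_on S" "\<And>x. x \<in> S \<Longrightarrow> F x - W k = exp (g x)"
      using simply_connected_imp_holomorphic_log[of "\<lambda>x. F x - W k" S] S omit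
        open_imp_locally_path_connected[OF S(1)] by auto
    thus ?thesis by (intro exI[of _ g]) auto
  qed
  then obtain l where l: "\<And>k. l k holomorphic_on S" "\<And>k x. x \<in> S \<Longrightarrow> exp (l k x) = F x - W k"
    by metis
  have cl: "continuous_on S (l k)" for k by (rule holomorphic_on_imp_continuous_on[OF l(1)])
  define \<kappa> where "\<kappa> = (\<lambda>k. l k z - l k x0 - Ln (F z - W k) + Ln (- (F x0 - W k)))"
  have pos: "Re (F z - W k) > 0" "Re (- (F x0 - W k)) > 0" for k using x0 z ReW by auto
  have "path_connected S" using S by (simp add: connected_open_path_connected)
  then obtain p where p: "path p" "path_image p \<subseteq> S" "pathstart p = x0" "pathfinish p = z"
    using x0 z unfolding path_connected_def by blast
  let ?K = "path_image p"
  have K: "connected ?K" "compact ?K" "x0 \<in> ?K" "z \<in> ?K"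
    using p by (auto simp: connected_path_image compact_path_image)
  have "compact ((\<lambda>x. Im (F x)) ` ?K)"
    using K p(2) by (intro compact_continuous_image continuous_intros continuous_on_subset[OF cF])
  hence "\<exists>B. \<forall>y \<in> (\<lambda>x. Im (F x)) ` ?K. \<bar>y\<bar> \<le> B"
    using bounded_real compact_imp_bounded by blast
  then obtain B where B: "\<And>x. x \<in> ?K \<Longrightarrow> \<bar>Im (F x)\<bar> \<le> B"
    by auto
  have incr: "l k z - l k x0 = Ln (c * (F z - W k)) - Ln (c * (F x0 - W k))"
    if "c \<noteq> 0" "\<And>x. x \<in> ?K \<Longrightarrow> Re (c * (F x - W k)) > 0" for k c
  proof (rule log_increment[OF K(1)])
    fix x assume "x \<in> ?K"
    show "c * (F x - W k) \<notin> \<real>\<^sub>\<le>\<^sub>0" using that(2)[OF \<open>x \<in> ?K\<close>] by (auto simp: complex_nonpos_Reals_iff)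
  qed (use that K p(2) l(2) in \<open>auto intro!: continuous_intros continuous_on_subset[OF cF] continuous_on_subset[OF cl]\<close>)
  have up: "\<kappa> k = \<i> * pi" if "Im (W k) > B" for k
  proof -
    have "l k z - l k x0 = Ln (\<i> * (F z - W k)) - Ln (\<i> * (F x0 - W k))"
      by (rule incr) (use B that in \<open>force+\<close>)
    also have "\<i> * (F x0 - W k) = - (\<i> * (- (F x0 - W k)))" by (simp add: algebra_simps)
    also have "Ln (\<i> * (F z - W k)) - Ln \<dots> = Ln (F z - W k) - Ln (- (F x0 - W k)) + \<i> * pi"
      unfolding Ln_rotate_right_half_plane[OF pos(1)] Ln_rotate_right_half_plane[OF pos(2)] by simp
    finally show ?thesis by (simp add: \<kappa>_def)
  qed
  have down: "\<kappa> k = - (\<i> * pi)" if "Im (W k) < - B" for k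
  proof -
    have "l k z - l k x0 = Ln (-\<i> * (F z - W k)) - Ln (-\<i> * (F x0 - W k))"
      by (rule incr) (use B that in \<open>force+\<close>)
    also have "-\<i> * (F x0 - W k) = \<i> * (- (F x0 - W k))" by (simp add: algebra_simps)
    also have "-\<i> * (F z - W k) = - (\<i> * (F z - W k))" by simp
    also have "Ln \<dots> - Ln (\<i> * (- (F x0 - W k))) = Ln (F z - W k) - Ln (- (F x0 - W k)) - \<i> * pi"
      unfolding Ln_rotate_right_half_plane[OF pos(1)] Ln_rotate_right_half_plane[OF pos(2)] by simp
    finally show ?thesis by (simp add: \<kappa>_def)
  qed
  obtain k1 :: int where "Im (W k1) > B"
  proof -
    obtain k :: int where "(B - Im w0) / (2*pi) < k" using ex_less_of_int by blast
    thus thesis by (intro that[of k]) (simp add: ImW field_simps)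
  qed
  moreover obtain k2 :: int where "Im (W k2) < - B"
  proof -
    obtain k :: int where "k < (- B - Im w0) / (2*pi)" using ex_of_int_less by blast
    thus thesis by (intro that[of k]) (simp add: ImW field_simps)
  qed
  ultimately have ne: "\<kappa> k1 \<noteq> \<kappa> k2" using up down by (simp add: complex_eq_iff)
  have "\<exists>k. \<not> connected_component {x\<in>S. F x \<notin> closed_segment (W k) (W (k+1))} x0 z"
  proof (rule ccontr)
    assume "\<not> ?thesis"
    hence cc: "connected_component {x\<in>S. F x \<notin> closed_segment (W k) (W (k+1))} x0 z" for k by blast
    \<comment> \<open>The quotient avoids the nonpositive real axis because \<open>F\<close> avoids the gap.\<close>
    have step: "\<kappa> k = \<kappa> (k+1)" for k
    proof -
      obtain T where T: "connected T" "T \<subseteq> {x\<in>S. F x \<notin> closed_segment (W k) (W (k+1))}" "x0 \<in> T" "z \<in> T"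
        using cc[of k] unfolding connected_component_def by blast
      have TS: "T \<subseteq> S" using T(2) by auto
      have nz: "F x - W j \<noteq> 0" if "x \<in> T" for x j using omit TS that by auto
      have "(l k z - l (k+1) z) - (l k x0 - l (k+1) x0) =
          Ln (1 * ((F z - W k) / (F z - W (k+1)))) - Ln (1 * ((F x0 - W k) / (F x0 - W (k+1))))"
      proof (rule log_increment[OF T(1)])
        fix x assume x: "x \<in> T"
        show "exp (l k x - l (k+1) x) = (F x - W k) / (F x - W (k+1))"
          using x TS l(2) by (auto simp: exp_diff)
        show "1 * ((F x - W k) / (F x - W (k+1))) \<notin> \<real>\<^sub>\<le>\<^sub>0"
          using quotient_nonpos_imp_in_segment[of "F x" "W (k+1)" "W k"] x T(2) nz by force
      qed (use nz T TS in \<open>auto intro!: continuous_intros continuous_on_subset[OF cF] continuous_on_subset[OF cl]\<close>)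
      also have "(F x0 - W k) / (F x0 - W (k+1)) = (- (F x0 - W k)) / (- (F x0 - W (k+1)))"
        by (rule minus_divide_divide[symmetric])
      finally show ?thesis
        unfolding mult_1 Ln_divide_right_half_plane[OF pos(1) pos(1)] Ln_divide_right_half_plane[OF pos(2) pos(2)]
        by (simp add: \<kappa>_def algebra_simps)
    qed
    have "\<kappa> k = \<kappa> 0" for k
      by (induction k rule: int_induct[of _ 0]) (use step[of "_ - 1"] step in auto)
    thus False using ne by metis
  qed
  thus ?thesis using that by blast
qed

section \<open>Images of Jordan domains cover annuli\<close>

lemma eventually_within_subset:
  "\<lbrakk>eventually P (at \<xi> within S); T \<subseteq> S\<rbrakk> \<Longrightarrow> eventually P (at \<xi> within T)"
  using at_le filter_leD by blast

text \<open>Here \<open>v\<close> is a competitor for the harmonic measure of \<open>\<sigma>\<close>, and \<open>z\<close> is a point whose image lies well to the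
right of the omitted lattice. All points of \<open>S\<close> near \<open>\<sigma>\<close> can be joined to \<open>x0\<close> on the left of the
lattice, so by the separation lemma the component \<open>\<Omega>\<close> of \<open>z\<close> off the preimage of one gap \<open>L\<close> does not
touch \<open>\<sigma>\<close>: the influence of \<open>\<sigma>\<close> on \<open>z\<close> comes through that gap only. It is estimated by the Green
function of the right half plane with pole at the end point \<open>A\<close> of the gap,
\<open>ln (norm (F x + cnj A) / norm (F x - A))\<close>. This is harmonic on all of \<open>S\<close> because \<open>F\<close> omits \<open>A\<close>, it is
at least \<open>ln (p / pi)\<close> on the gap, and it is small at distance \<open>\<eta>\<close> from \<open>A\<close>.\<close>

lemma subharmonic_small_far_from_gaps:
  fixes F :: "complex \<Rightarrow> complex" and w0 :: complex and p \<eta> :: real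
  defines "W \<equiv> \<lambda>k::int. w0 + 2 * of_real pi * \<i> * of_int k"
  assumes S: "jordan_domain S" and F: "F holomorphic_on S" and Fpos: "\<And>x. x \<in> S \<Longrightarrow> Re (F x) > 0"
    and omit: "\<And>k x. x \<in> S \<Longrightarrow> F x \<noteq> W k" and p: "Re w0 = p" "p > pi"
    and \<sigma>: "\<sigma> \<subseteq> frontier S" "connected \<sigma>" "\<sigma> \<noteq> {}"
    and near: "\<And>\<zeta>. \<zeta> \<in> \<sigma> \<Longrightarrow> \<forall>\<^sub>F x in at \<zeta> within S. Re (F x) < p"
    and v: "subharmonic_on v S" "\<And>x. x \<in> S \<Longrightarrow> v x \<le> 1"
    and off: "\<And>\<xi> e. \<lbrakk>\<xi> \<in> frontier S - \<sigma>; e > 0\<rbrakk> \<Longrightarrow> \<forall>\<^sub>F x in at \<xi> within S. v x < e"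
    and \<eta>: "\<eta> > 0" and z: "z \<in> S" "Re (F z) \<ge> p + \<eta>"
  shows "v z \<le> (2 * p / \<eta>) / ln (p / pi)"
proof -
  note SD = jordan_domainD[OF S]
  have cF: "continuous_on S F" by (rule holomorphic_on_imp_continuous_on[OF F])
  have "p > 0" using p pi_gt_zero by linarith
  define V where "V = {x\<in>S. Re (F x) < p}"
  have "\<exists>e>0. S \<inter> ball \<zeta> e \<subseteq> V" if \<zeta>: "\<zeta> \<in> \<sigma>" for \<zeta>
  proof -
    have "\<zeta> \<notin> S" using \<zeta> \<sigma>(1) SD(1) by (auto simp: frontier_def interior_open)
    obtain d where d: "d > 0" "\<And>x. \<lbrakk>x \<in> S; x \<noteq> \<zeta>; dist x \<zeta> < d\<rbrakk> \<Longrightarrow> Re (F x) < p"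
      using near[OF \<zeta>] unfolding eventually_at by blast
    show ?thesis
    proof (intro exI[of _ d] conjI subsetI d(1))
      fix x assume "x \<in> S \<inter> ball \<zeta> d"
      thus "x \<in> V" using d(2)[of x] \<open>\<zeta> \<notin> S\<close> by (cases "x = \<zeta>") (auto simp: V_def dist_commute)
    qed
  qed
  with connected_boundary_set_adjoins_one_component[OF S \<sigma>(2,3,1)]
  obtain x0 where x0: "x0 \<in> V" "x0 \<in> S" 
    and adj: "\<And>\<zeta>. \<zeta> \<in> \<sigma> \<Longrightarrow> \<exists>d>0. \<forall>x\<in>S \<inter> ball \<zeta> d. connected_component V x0 x"
    by metis
  obtain k where k: "\<not> connected_component {x\<in>S. F x \<notin> closed_segment (W k) (W (k+1))} x0 z"
  proof (rule omitted_lattice_separates[of S F w0 x0 z, OF SD(1,2,4) F _ x0(2) _ z(1)])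
    show "F x \<noteq> w0 + 2 * of_real pi * \<i> * of_int k" if "x \<in> S" for k x
      using omit[OF that] by (simp add: W_def)
    show "Re (F x0) < Re w0" using x0 p by (simp add: V_def)
    show "Re (F z) > Re w0" using z p \<eta> by simp
    fix k assume "\<not> connected_component {x\<in>S. F x \<notin> closed_segment (w0 + 2 * of_real pi * \<i> * of_int k)
        (w0 + 2 * of_real pi * \<i> * of_int (k+1))} x0 z"
    thus thesis by (intro that[of k]) (simp only: W_def not_False_eq_True)
  qed
  define A where "A = W k"
  define L where "L = closed_segment (W k) (W (k+1))"
  define U where "U = {x\<in>S. F x \<notin> L}"
  have ReL: "Re w = p" and distL: "norm (w - A) \<le> 2 * pi" if "w \<in> L" for w
  proof -
    from that obtain u where u: "0 \<le> u" "u \<le> 1" "w = (1 - u) *\<^sub>R W k + u *\<^sub>R W (k+1)"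
      unfolding L_def in_segment by blast
    have w: "w = A + of_real u * (2 * of_real pi * \<i>)"
      unfolding u(3) A_def by (simp add: W_def scaleR_conv_of_real algebra_simps)
    show "Re w = p" using p by (simp add: w A_def W_def)
    show "norm (w - A) \<le> 2 * pi" using u(1,2) by (simp add: w norm_mult)
  qed
  have VU: "V \<subseteq> U" using ReL by (auto simp: V_def U_def)
  have "open U"
  proof -
    have "open (S \<inter> F -` (- L))"
      using SD(1) cF by (intro continuous_open_preimage) (auto simp: L_def)
    moreover have "S \<inter> F -` (- L) = U" by (auto simp: U_def)
    ultimately show ?thesis by simp
  qed
  define \<Omega> where "\<Omega> = connected_component_set U z"
  have z\<Omega>: "z \<in> \<Omega>" using z ReL \<eta> by (force simp: \<Omega>_def U_def)
  have op: "open \<Omega>" unfolding \<Omega>_def by (rule open_connected_component[OF \<open>open U\<close>])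
  have \<Omega>U: "\<Omega> \<subseteq> U" unfolding \<Omega>_def by (rule connected_component_subset)
  have \<Omega>S: "\<Omega> \<subseteq> S" using \<Omega>U by (auto simp: U_def)
  obtain l where l: "l holomorphic_on S" "\<And>x. x \<in> S \<Longrightarrow> F x - A = exp (l x)"
  proof (rule simply_connected_imp_holomorphic_log[of "\<lambda>x. F x - A" S])
    show "(\<lambda>x. F x - A) holomorphic_on S" by (intro holomorphic_intros F)
    show "locally path_connected S" by (rule open_imp_locally_path_connected[OF SD(1)])
  qed (use SD omit in \<open>auto simp: A_def\<close>)
  have lnp: "ln (p / pi) > 0" using p(2) pi_gt_zero by (intro ln_gt_zero) (simp add: field_simps)
  have ReA: "Re A = p" using p by (simp add: A_def W_def)
  \<comment> \<open>The real part of \<open>G\<close> is the Green function, normalised to be at least 1 on the gap.\<close>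
  define G where "G = (\<lambda>x. (Ln (F x + cnj A) - l x) / of_real (ln (p / pi)))"
  have num: "Re (F x + cnj A) > 0" if "x \<in> S" for x using Fpos[OF that] ReA \<open>p > 0\<close> by simp
  have nz: "norm (F x - A) > 0" if "x \<in> S" for x using l(2)[OF that] by simp
  have hG: "G holomorphic_on S" unfolding G_def
    using num lnp by (intro holomorphic_intros F l) (force simp: complex_nonpos_Reals_iff)+
  have ReG: "Re (G x) = ln (norm (F x + cnj A) / norm (F x - A)) / ln (p / pi)" if "x \<in> S" for x
  proof -
    have "F x + cnj A \<noteq> 0" using num[OF that] by (metis less_irrefl zero_complex.sel(1))
    moreover have "Re (l x) = ln (norm (F x - A))" using l(2)[OF that] by simp
    ultimately show ?thesis using nz[OF that] by (simp add: G_def ln_div Re_divide_of_real)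
  qed
  have G0: "Re (G x) \<ge> 0" if "x \<in> S" for x
  proof -
    have "(norm (F x - A))\<^sup>2 \<le> (norm (F x + cnj A))\<^sup>2"
      using Fpos[OF that] ReA \<open>p > 0\<close> unfolding cmod_power2 by (simp add: power2_eq_square algebra_simps)
    hence "norm (F x - A) \<le> norm (F x + cnj A)" by (rule power2_le_imp_le) simp
    thus ?thesis using nz[OF that] lnp by (simp add: ReG[OF that])
  qed
  \<comment> \<open>On the gap, \<open>F x\<close> has distance at least \<open>2 * p\<close> from \<open>- cnj A\<close> and at most \<open>2 * pi\<close> from \<open>A\<close>.\<close>
  have G1: "Re (G x) \<ge> 1" if "x \<in> S" "F x \<in> L" for x
  proof -
    have "2 * p \<le> norm (F x + cnj A)"
      using ReL[OF that(2)] ReA complex_Re_le_cmod[of "F x + cnj A"] by simp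
    hence "(2 * p) / (2 * pi) \<le> norm (F x + cnj A) / norm (F x - A)"
      using distL[OF that(2)] nz[OF that(1)] \<open>p > 0\<close> by (intro frac_le) auto
    hence "ln (p / pi) \<le> ln (norm (F x + cnj A) / norm (F x - A))"
      using \<open>p > 0\<close> by (intro ln_mono) auto
    thus ?thesis using lnp by (simp add: ReG[OF that(1)])
  qed
  have "v z \<le> Re (G z)"
  proof (rule subharmonic_le_harmonic[OF op _ \<Omega>S v(1) _ _ z\<Omega>])
    show "bounded \<Omega>" using SD(3) \<Omega>S by (rule bounded_subset)
    show "G holomorphic_on \<Omega>" using hG \<Omega>S by (rule holomorphic_on_subset)
    fix \<xi> :: complex and e :: real assume \<xi>: "\<xi> \<in> frontier \<Omega>" and e: "e > 0"
    have \<xi>c: "\<xi> \<in> closure \<Omega>" "\<xi> \<notin> \<Omega>" using \<xi> op by (auto simp: frontier_def interior_open)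
    show "\<forall>\<^sub>F x in at \<xi> within \<Omega>. v x < Re (G x) + e"
    proof (cases "\<xi> \<in> S")
      case True
      have "F \<xi> \<in> L"
      proof (rule ccontr)
        assume "F \<xi> \<notin> L"
        hence "\<xi> \<in> U" using True by (simp add: U_def)
        moreover obtain T where T: "closed T" "\<Omega> = U \<inter> T"
          using closedin_connected_component[of U z] unfolding \<Omega>_def closedin_closed by blast
        have "\<xi> \<in> T" using closure_minimal[of \<Omega> T] T \<xi>c(1) by blast
        ultimately show False using T \<xi>c(2) by blast
      qed
      hence "Re (G \<xi>) > 1 - e" using G1[OF True] e by linarith
      moreover have "((\<lambda>x. Re (G x)) \<longlongrightarrow> Re (G \<xi>)) (at \<xi> within S)"
        using holomorphic_on_imp_continuous_on[OF hG] True
        by (intro tendsto_Re) (simp add: continuous_on_def)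
      ultimately have "\<forall>\<^sub>F x in at \<xi> within S. Re (G x) > 1 - e" by (rule order_tendstoD(1)[rotated])
      moreover have "\<forall>\<^sub>F x in at \<xi> within S. x \<in> S" by (simp add: eventually_at_filter)
      ultimately have "\<forall>\<^sub>F x in at \<xi> within S. v x < Re (G x) + e"
        by eventually_elim (use v(2) in force)
      thus ?thesis by (rule eventually_within_subset[OF _ \<Omega>S])
    next
      case False
      hence fr: "\<xi> \<in> frontier S" using \<xi>c closure_mono[OF \<Omega>S] SD(1) by (auto simp: frontier_def interior_open)
      have "\<xi> \<notin> \<sigma>"
      proof
        assume "\<xi> \<in> \<sigma>"
        then obtain d where d: "d > 0" "\<And>x. x\<in>S \<inter> ball \<xi> d \<Longrightarrow> connected_component V x0 x" using adj by blast
        obtain y where y: "y \<in> \<Omega>" "dist y \<xi> < d" using \<xi>c(1) d(1) by (auto simp: closure_approachable)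
        have "connected_component U x0 y"
          by (rule connected_component_of_subset[OF d(2) VU]) (use y \<Omega>S in \<open>auto simp: dist_commute\<close>)
        moreover have "connected_component U y z" using y(1) by (simp add: \<Omega>_def connected_component_sym)
        ultimately show False using k connected_component_trans unfolding U_def L_def by blast
      qed
      hence "\<forall>\<^sub>F x in at \<xi> within S. v x < e" using off[of \<xi> e] fr e by blast
      moreover have "\<forall>\<^sub>F x in at \<xi> within S. x \<in> S" by (simp add: eventually_at_filter)
      ultimately have "\<forall>\<^sub>F x in at \<xi> within S. v x < Re (G x) + e"
        by eventually_elim (use G0 in force)
      thus ?thesis by (rule eventually_within_subset[OF _ \<Omega>S])
    qed
  qed
  also have "\<dots> \<le> (2 * p / \<eta>) / ln (p / pi)"
  proof -
    have far: "\<eta> \<le> norm (F z - A)"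
      using z ReA complex_Re_le_cmod[of "F z - A"] by simp
    have "F z + cnj A = (F z - A) + of_real (2 * p)"
      using ReA by (simp add: complex_eq_iff)
    moreover have "norm (of_real (2 * p) :: complex) = 2 * p" using \<open>p > 0\<close> by simp
    ultimately have "norm (F z + cnj A) \<le> norm (F z - A) + 2 * p"
      using norm_triangle_ineq[of "F z - A" "of_real (2 * p)"] by (simp only:)
    hence "norm (F z + cnj A) / norm (F z - A) \<le> (norm (F z - A) + 2 * p) / norm (F z - A)"
      by (rule divide_right_mono) simp
    also have "\<dots> = 1 + 2 * p / norm (F z - A)" using nz[OF z(1)] by (simp add: field_simps)
    also have "\<dots> \<le> 1 + 2 * p / \<eta>"
      using far \<eta> \<open>p > 0\<close> by (intro add_left_mono divide_left_mono mult_pos_pos) auto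
    finally have le: "norm (F z + cnj A) / norm (F z - A) \<le> 1 + 2 * p / \<eta>" .
    have "F z + cnj A \<noteq> 0" using num[OF z(1)] by (metis less_irrefl zero_complex.sel(1))
    hence "ln (norm (F z + cnj A) / norm (F z - A)) \<le> ln (1 + 2 * p / \<eta>)"
      using le nz[OF z(1)] by (intro ln_mono) auto
    also have "\<dots> \<le> 2 * p / \<eta>" using \<open>p > 0\<close> \<eta> by (intro ln_add_one_self_le_self) simp
    finally show ?thesis unfolding ReG[OF z(1)] using lnp by (intro divide_right_mono) auto
  qed
  finally show ?thesis .
qed

text \<open>The previous lemma bounds \<open>v\<close> by \<open>s\<close> wherever \<open>Re F\<close> is at least \<open>p' = p + \<eta> * u\<close>, which is only slightly
beyond the lattice; a point \<open>z\<close> with \<open>Re (F z)\<close> equal to \<open>p\<close> itself could sit arbitrarily close to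
a gap. On the remaining set \<open>Re F < p'\<close> the function \<open>v\<close> is compared with \<open>s + 1 - Re F / p'\<close>, whose
boundary values are at least \<open>s\<close> on the line \<open>Re F = p'\<close>, at least 0 on the rest of the boundary and
more than 1 on \<open>\<sigma>\<close>. Since \<open>Re (F z) \<ge> p\<close>, the value of this function at \<open>z\<close> exceeds \<open>s\<close> by at most \<open>\<eta>\<close>.\<close>

lemma harmonic_measure_small_if_value_omitted:
  fixes F :: "complex \<Rightarrow> complex" and w0 :: complex and \<eta> :: real
  assumes S: "jordan_domain S" and F: "F holomorphic_on S" and Fpos: "\<And>x. x \<in> S \<Longrightarrow> Re (F x) > 0"
    and omit: "\<And>x (k::int). x \<in> S \<Longrightarrow> F x \<noteq> w0 + 2 * of_real pi * \<i> * of_int k"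
    and \<sigma>: "\<sigma> \<subseteq> frontier S" "connected \<sigma>" "\<sigma> \<noteq> {}"
    and near: "\<And>\<zeta> e. \<lbrakk>\<zeta> \<in> \<sigma>; e > 0\<rbrakk> \<Longrightarrow> \<forall>\<^sub>F x in at \<zeta> within S. Re (F x) < e"
    and z: "z \<in> S" "Re w0 \<le> Re (F z)" "Re w0 > pi" and \<eta>: "\<eta> > 0"
    and v: "subharmonic_on v S"
    and lim: "\<And>\<xi>. \<xi> \<in> frontier S \<Longrightarrow> Limsup (at \<xi> within S) (\<lambda>x. ereal (v x)) \<le> ereal (indicator \<sigma> \<xi>)"
  shows "v z \<le> 2 / (\<eta> * ln (Re w0 / pi)) + \<eta>"
proof -
  note SD = jordan_domainD[OF S]
  define p where "p = Re w0"
  define u where "u = Re (F z)"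
  define p' where "p' = p + \<eta> * u"
  define s where "s = 2 / (\<eta> * ln (p / pi))"
  have pos: "p > pi" "p > 0" "u \<ge> p" "u > 0" using z pi_gt_zero by (auto simp: p_def u_def simp del: pi_gt_zero)
  have lnp: "ln (p / pi) > 0" using pos(1) pi_gt_zero by (intro ln_gt_zero) (simp add: field_simps)
  have p': "p' > 0" using pos \<eta> by (auto simp: p'_def intro!: add_pos_pos)
  have s0: "s > 0" using lnp \<eta> by (simp add: s_def)
  have bd: "\<forall>\<^sub>F x in at \<xi> within S. v x < indicator \<sigma> \<xi> + e" if "\<xi> \<in> frontier S" "e > 0" for \<xi> and e :: real
  proof -
    have "Limsup (at \<xi> within S) (\<lambda>x. ereal (v x)) < ereal (indicator \<sigma> \<xi> + e)"
      using lim[OF that(1)] that(2) by (rule_tac le_less_trans) auto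
    from Limsup_lessD[OF this] show ?thesis by simp
  qed
  have inS: "\<forall>\<^sub>F x in at \<xi> within S. x \<in> S" for \<xi> by (simp add: eventually_at_filter)
  have v1: "v x \<le> 1" if "x \<in> S" for x
  proof -
    have "v x \<le> Re ((\<lambda>_. 1) x)"
    proof (rule subharmonic_le_harmonic[OF SD(1,3) order_refl v _ _ that])
      fix \<xi> :: complex and e :: real assume \<xi>: "\<xi> \<in> frontier S" "e > 0"
      show "\<forall>\<^sub>F x in at \<xi> within S. v x < Re 1 + e"
        using bd[OF \<xi>]
      proof eventually_elim
        case (elim x)
        moreover have "indicator \<sigma> \<xi> \<le> (1::real)" by (simp add: indicator_def)
        ultimately show ?case unfolding one_complex.sel by linarith
      qed
    qed auto
    thus ?thesis by simp
  qed
  have off: "\<forall>\<^sub>F x in at \<xi> within S. v x < e" if "\<xi> \<in> frontier S - \<sigma>" "e > 0" for \<xi> e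
    using bd[of \<xi> e] that by simp
  have far: "v x \<le> s" if "x \<in> S" "Re (F x) \<ge> p'" for x
  proof -
    have "v x \<le> (2 * p / (\<eta> * u)) / ln (p / pi)"
      by (rule subharmonic_small_far_from_gaps[OF S F Fpos omit _ _ \<sigma> near v v1 off])
         (use that pos \<eta> in \<open>auto simp: p_def p'_def\<close>)
    also have "\<dots> \<le> (2 / \<eta>) / ln (p / pi)"
      using pos \<eta> lnp by (intro divide_right_mono) (auto simp: field_simps)
    finally show ?thesis by (simp add: s_def)
  qed
  show ?thesis
  proof (cases "u \<ge> p'")
    case True
    thus ?thesis using far[OF z(1)] \<eta> by (simp add: u_def s_def p_def)
  next
    case False
    define \<Omega> where "\<Omega> = {x\<in>S. Re (F x) < p'}"
    define G where "G = (\<lambda>x. of_real (s + 1) - F x / of_real p')"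
    have \<Omega>S: "\<Omega> \<subseteq> S" by (auto simp: \<Omega>_def)
    have ReG: "Re (G x) = s + 1 - Re (F x) / p'" for x by (simp add: G_def Re_divide_of_real)
    have hG: "G holomorphic_on S" unfolding G_def using p' by (intro holomorphic_intros F) auto
    have cF: "continuous_on S (\<lambda>x. Re (F x))"
      by (intro continuous_intros holomorphic_on_imp_continuous_on[OF F])
    have op: "open \<Omega>"
    proof -
      have "open (S \<inter> (\<lambda>x. Re (F x)) -` {..<p'})"
        using SD(1) cF by (intro continuous_open_preimage) auto
      moreover have "S \<inter> (\<lambda>x. Re (F x)) -` {..<p'} = \<Omega>" by (auto simp: \<Omega>_def)
      ultimately show ?thesis by simp
    qed
    have "v z \<le> Re (G z)"
    proof (rule subharmonic_le_harmonic[OF op _ \<Omega>S v])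
      show "bounded \<Omega>" using SD(3) \<Omega>S by (rule bounded_subset)
      show "G holomorphic_on \<Omega>" using hG \<Omega>S by (rule holomorphic_on_subset)
      show "z \<in> \<Omega>" using z False by (simp add: \<Omega>_def u_def)
      fix \<xi> :: complex and e :: real assume \<xi>: "\<xi> \<in> frontier \<Omega>" and e: "e > 0"
      have \<xi>c: "\<xi> \<in> closure \<Omega>" "\<xi> \<notin> \<Omega>" using \<xi> op by (auto simp: frontier_def interior_open)
      have in\<Omega>: "\<forall>\<^sub>F x in at \<xi> within \<Omega>. x \<in> \<Omega>" by (simp add: eventually_at_filter)
      have fr: "\<xi> \<in> frontier S" if "\<xi> \<notin> S"
        using that \<xi>c closure_mono[OF \<Omega>S] SD(1) by (auto simp: frontier_def interior_open)
      consider "\<xi> \<in> S" | "\<xi> \<in> frontier S - \<sigma>" | "\<xi> \<in> \<sigma>" using fr by blast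
      thus "\<forall>\<^sub>F x in at \<xi> within \<Omega>. v x < Re (G x) + e"
      proof cases
        case 1
        have ge: "Re (F \<xi>) \<ge> p'" using \<xi>c(2) 1 by (auto simp: \<Omega>_def)
        have tF: "((\<lambda>x. Re (F x)) \<longlongrightarrow> Re (F \<xi>)) (at \<xi> within \<Omega>)"
          using cF 1 \<Omega>S by (meson continuous_on_def tendsto_within_subset)
        have tv: "(v \<longlongrightarrow> v \<xi>) (at \<xi> within \<Omega>)"
          using v 1 \<Omega>S unfolding subharmonic_on_def by (meson continuous_on_def tendsto_within_subset)
        have "\<forall>\<^sub>F x in at \<xi> within \<Omega>. v x < s + e"
          using far[OF 1 ge] e by (intro order_tendstoD(2)[OF tv]) linarith
        with in\<Omega> show ?thesis
        proof eventually_elim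
          case (elim x)
          have "Re (F x) / p' \<le> 1" using elim p' by (simp add: \<Omega>_def)
          thus ?case using elim by (simp add: ReG)
        qed
      next
        case 2
        from eventually_within_subset[OF off[OF 2 e] \<Omega>S] in\<Omega> show ?thesis
        proof eventually_elim
          case (elim x)
          have "Re (F x) / p' \<le> 1" using elim p' by (simp add: \<Omega>_def)
          thus ?case using elim s0 by (simp add: ReG)
        qed
      next
        case 3
        have "e * p' > 0" using e p' by simp
        from eventually_within_subset[OF near[OF 3 this] \<Omega>S] in\<Omega> show ?thesis
        proof eventually_elim
          case (elim x)
          have "Re (F x) / p' < e" using elim p' by (simp add: field_simps)
          moreover have "v x \<le> 1" using v1 elim \<Omega>S by auto
          ultimately show ?case using s0 by (simp add: ReG)
        qed
      qed
    qed
    also have "\<dots> \<le> s + \<eta>"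
    proof -
      have "1 - u / p' = (p' - u) / p'" using p' by (simp add: field_simps)
      also have "\<dots> \<le> \<eta> * u / p'" using p' pos by (intro divide_right_mono) (auto simp: p'_def)
      also have "\<dots> \<le> \<eta> * 1" 
        using False \<eta> p' by (simp add: field_simps)
      finally show ?thesis by (simp add: ReG u_def)
    qed
    finally show ?thesis by (simp add: s_def p_def)
  qed
qed

text \<open>The covering theorem. If \<open>w\<close> were omitted by \<open>f\<close>, a logarithm \<open>F\<close> of \<open>f\<close> on \<open>S\<close> would omit the whole
lattice of logarithms of \<open>w\<close>, and then every competitor for the harmonic measure would be too small at
\<open>z\<close>. The radius \<open>R\<close> depends on \<open>c\<close> alone.\<close>

lemma image_covers_annulus:
  fixes c :: real
  assumes c: "c > 0"
  obtains R where "R > 1" and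
    "\<And>(f :: complex \<Rightarrow> complex) S \<sigma> z w. \<lbrakk>jordan_domain S; f holomorphic_on S; continuous_on (closure S) f;
       \<And>x. x \<in> S \<Longrightarrow> norm (f x) > 1; \<sigma> \<subseteq> frontier S; connected \<sigma>; \<sigma> \<noteq> {};
       \<And>x. x \<in> \<sigma> \<Longrightarrow> norm (f x) = 1; z \<in> S; harmonic_measure S \<sigma> z \<ge> c;
       R \<le> norm w; norm w \<le> norm (f z)\<rbrakk> \<Longrightarrow> w \<in> f ` S"
proof -
  \<comment> \<open>With \<open>\<eta> = c / 4\<close> the bound \<open>2 / (\<eta> * ln (p0 / pi)) + \<eta>\<close> is \<open>c / 8 + c / 4\<close>, which is
      less than \<open>c / 2\<close>.\<close>
  define p0 where "p0 = pi * exp (64 / c\<^sup>2)"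
  have p0: "p0 > pi" "ln (p0 / pi) = 64 / c\<^sup>2" "p0 > 0" using c by (auto simp: p0_def)
  show ?thesis
  proof (rule that[of "exp p0"])
    show "exp p0 > 1" using p0 by simp
    fix f :: "complex \<Rightarrow> complex" and S \<sigma> :: "complex set" and z w :: complex
    assume S: "jordan_domain S" and f: "f holomorphic_on S" and cf: "continuous_on (closure S) f"
      and f1: "\<And>x. x \<in> S \<Longrightarrow> norm (f x) > 1" and \<sigma>: "\<sigma> \<subseteq> frontier S" "connected \<sigma>" "\<sigma> \<noteq> {}"
      and f\<sigma>: "\<And>x. x \<in> \<sigma> \<Longrightarrow> norm (f x) = 1" and z: "z \<in> S" and hm: "harmonic_measure S \<sigma> z \<ge> c"
      and w: "exp p0 \<le> norm w" "norm w \<le> norm (f z)"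
    note SD = jordan_domainD[OF S]
    show "w \<in> f ` S"
    proof (rule ccontr)
      assume omitw: "w \<notin> f ` S"
      obtain F where F: "F holomorphic_on S" "\<And>x. x \<in> S \<Longrightarrow> f x = exp (F x)"
      proof (rule simply_connected_imp_holomorphic_log[OF f SD(4)])
        show "locally path_connected S" by (rule open_imp_locally_path_connected[OF SD(1)])
        show "f x \<noteq> 0" if "x \<in> S" for x using f1[OF that] by auto
      qed auto
      have ReF: "Re (F x) = ln (norm (f x))" if "x \<in> S" for x using F(2)[OF that] by simp
      have wn: "norm w > 0" using w(1) by (smt (verit) exp_gt_zero)
      hence w0: "w \<noteq> 0" by auto
      have ReLn: "Re (Ln w) = ln (norm w)" using w0 by simp
      have pw: "p0 \<le> Re (Ln w)" unfolding ReLn using w(1) wn by (simp add: ln_ge_iff)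
      define \<eta> where "\<eta> = c / 4"
      define X where "X = {u z | u. subharmonic_on u S \<and>
         (\<forall>w\<in>frontier S. Limsup (at w within S) (\<lambda>x. ereal (u x)) \<le> ereal (indicator \<sigma> w))}"
      \<comment> \<open>A real supremum yields elements close to it only for a nonempty set.\<close>
      have "0 \<in> X"
      proof -
        have "subharmonic_on (\<lambda>_. 0) S" by (simp add: subharmonic_on_def)
        moreover have "Limsup (at w within S) (\<lambda>x. ereal 0) \<le> ereal (indicator \<sigma> w)" for w
          by (rule order_trans[OF Limsup_bounded[where C = 0]]) auto
        ultimately show ?thesis unfolding X_def mem_Collect_eq by (intro exI[of _ "\<lambda>_. 0"] conjI) blast+
      qed
      moreover have "c / 2 < Sup X" using hm c unfolding harmonic_measure_def X_def by linarith
      ultimately obtain v where v: "subharmonic_on v S" "c / 2 < v z"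
        "\<And>\<xi>. \<xi> \<in> frontier S \<Longrightarrow> Limsup (at \<xi> within S) (\<lambda>x. ereal (v x)) \<le> ereal (indicator \<sigma> \<xi>)"
      proof -
        assume hyp: "0 \<in> X" "c / 2 < Sup X"
        then obtain y where "y \<in> X" "c / 2 < y" using less_cSupD[of X "c / 2"] by blast
        with that show thesis unfolding X_def mem_Collect_eq by blast
      qed
      have "v z \<le> 2 / (\<eta> * ln (Re (Ln w) / pi)) + \<eta>"
      proof (rule harmonic_measure_small_if_value_omitted[OF S F(1) _ _ \<sigma> _ z _ _ _ v(1,3)])
        show "Re (F x) > 0" if "x \<in> S" for x using ln_gt_zero[OF f1[OF that]] by (simp add: ReF[OF that])
        show "F x \<noteq> Ln w + 2 * of_real pi * \<i> * of_int k" if "x \<in> S" for x and k :: int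
        proof
          assume eq: "F x = Ln w + 2 * of_real pi * \<i> * of_int k"
          have "exp (2 * of_real pi * \<i> * of_int k) = (1::complex)"
            using exp_eq_1[of "2 * of_real pi * \<i> * of_int k :: complex"] by auto
          hence "f x = w" using F(2)[OF that] eq w0 by (simp add: exp_add)
          thus False using omitw that by blast
        qed
        show "Re (Ln w) \<le> Re (F z)" unfolding ReLn ReF[OF z] using w(2) wn by (intro ln_mono) auto
        show "pi < Re (Ln w)" using pw p0 by linarith
        show "\<eta> > 0" using c by (simp add: \<eta>_def)
        fix \<zeta> :: complex and e :: real assume \<zeta>: "\<zeta> \<in> \<sigma>" and e: "e > 0"
        have "(f \<longlongrightarrow> f \<zeta>) (at \<zeta> within closure S)"
          using cf \<zeta> \<sigma>(1) by (auto simp: continuous_on_def frontier_def)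
        hence "(f \<longlongrightarrow> f \<zeta>) (at \<zeta> within S)" by (rule tendsto_within_subset) (rule closure_subset)
        hence "((\<lambda>x. norm (f x)) \<longlongrightarrow> 1) (at \<zeta> within S)" using f\<sigma>[OF \<zeta>] tendsto_norm by fastforce
        hence "\<forall>\<^sub>F x in at \<zeta> within S. norm (f x) < exp e" by (rule order_tendstoD(2)) (use e in simp)
        moreover have "\<forall>\<^sub>F x in at \<zeta> within S. x \<in> S" by (simp add: eventually_at_filter)
        ultimately show "\<forall>\<^sub>F x in at \<zeta> within S. Re (F x) < e"
        proof eventually_elim
          case (elim x)
          thus ?case using F(2)[of x] by simp
        qed
      qed
      also have "2 / (\<eta> * ln (Re (Ln w) / pi)) \<le> 2 / (\<eta> * (64 / c\<^sup>2))"
      proof -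
        have "64 / c\<^sup>2 \<le> ln (Re (Ln w) / pi)"
          unfolding p0(2)[symmetric] using pw p0 by (intro ln_mono divide_right_mono) auto
        moreover have "64 / c\<^sup>2 > 0" using c by simp
        moreover from calculation have "ln (Re (Ln w) / pi) > 0" by linarith
        ultimately show ?thesis using c by (intro divide_left_mono mult_left_mono mult_pos_pos) (auto simp: \<eta>_def)
      qed
      also have "2 / (\<eta> * (64 / c\<^sup>2)) = c / 8" using c by (simp add: \<eta>_def power2_eq_square field_simps)
      finally show False using v(2) c by (simp add: \<eta>_def)
    qed
  qed
qed

section \<open>Slow itineraries\<close>

text \<open>Indices at which \<open>M\<close> attains its minimum over all later indices; call them records. They are the
indices at which an itinerary can be held up.\<close>

lemma exists_record:
  fixes M :: "nat \<Rightarrow> real"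
  assumes "filterlim M at_top sequentially"
  obtains r where "r \<ge> K" "\<And>l. l \<ge> r \<Longrightarrow> M r \<le> M l"
proof -
  have "\<forall>\<^sub>F l in sequentially. M l \<ge> M K + 1" using assms by (simp add: filterlim_at_top)
  then obtain N where N: "\<And>l. l \<ge> N \<Longrightarrow> M l \<ge> M K + 1" by (auto simp: eventually_sequentially)
  have "K < N" using N[of K] by (meson not_le_imp_less less_add_one not_less)
  obtain r where r: "r \<in> {K..<N}" "\<And>l. l \<in> {K..<N} \<Longrightarrow> M r \<le> M l"
    using ex_min_if_finite[of "M ` {K..<N}"] \<open>K < N\<close> by (auto simp: not_less)
  show ?thesis
  proof (rule that[of r])
    fix l assume "l \<ge> r"
    show "M r \<le> M l"
    proof (cases "l < N")
      case True
      thus ?thesis using r(2)[of l] \<open>l \<ge> r\<close> r(1) by auto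
    next
      case False
      have "M r \<le> M K" using r(2)[of K] \<open>K < N\<close> by auto
      thus ?thesis using N[of l] False by simp
    qed
  qed (use r in auto)
qed

text \<open>An itinerary \<open>j\<close> may pass from \<open>n\<close> to any \<open>k\<close> with \<open>M k \<le> M (Suc n)\<close>. It steps up to \<open>Suc n\<close> whenever
\<open>a\<close> stays large enough from then on, and otherwise falls back to the last record up to its position, which is always
permitted and never increases \<open>M\<close>. It never falls below a record that it has reached, and since
\<open>a\<close> tends to infinity, the itinerary eventually climbs uninterruptedly to any given record.\<close>

lemma slow_itinerary:
  fixes M a :: "nat \<Rightarrow> real"
  assumes M: "filterlim M at_top sequentially" and a: "filterlim a at_top sequentially"
    and r0: "\<And>l. l \<ge> r0 \<Longrightarrow> M r0 \<le> M l"
  obtains j where "j 0 = r0" "\<And>t. M (j (Suc t)) \<le> M (Suc (j t))"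
    "filterlim j at_top sequentially" "\<forall>\<^sub>F t in sequentially. M (j t) \<le> a t"
proof -
  define is_record where "is_record = (\<lambda>r. \<forall>l\<ge>r. M r \<le> M l)"
  \<comment> \<open>Since \<open>a\<close> tends to infinity, \<open>b\<close> eventually agrees with \<open>a\<close>; the lower bound makes the
      starting position admissible.\<close>
  define b where "b = (\<lambda>t. max (a t) (M r0))"
  define retreat where "retreat = (\<lambda>n. Max {r. r \<le> n \<and> is_record r})"
  define j where "j = rec_nat r0 (\<lambda>t n. if \<forall>s>t. M (Suc n) \<le> b s then Suc n else retreat n)"
  have j0: "j 0 = r0" by (simp add: j_def)
  have jS: "j (Suc t) = (if \<forall>s>t. M (Suc (j t)) \<le> b s then Suc (j t) else retreat (j t))" for t
    by (simp add: j_def cong: if_cong split del: if_split)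
  have retreat: "is_record (retreat n)" "retreat n \<le> n" if "n \<ge> r0" for n
  proof -
    have "retreat n \<in> {r. r \<le> n \<and> is_record r}" unfolding retreat_def
      by (rule Max_in) (use r0 that in \<open>auto simp: is_record_def\<close>)
    thus "is_record (retreat n)" "retreat n \<le> n" by auto
  qed
  have retreat_ge: "r \<le> retreat n" if "r \<le> n" "is_record r" for r n
    unfolding retreat_def by (rule Max_ge) (use that in auto)
  have rec0: "is_record r0" using r0 by (simp add: is_record_def)
  have ge: "j t \<ge> R" if "j t0 \<ge> R" "t \<ge> t0" "is_record R" for t t0 R
    using that(2,1)
  proof (induction t rule: dec_induct)
    case (step t)
    thus ?case using retreat_ge[of R "j t"] that(3) by (auto simp: jS)
  qed auto
  have jr0: "j t \<ge> r0" for t using ge[of r0 0 t] j0 rec0 by simp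
  have inv: "\<forall>s\<ge>t. M (j t) \<le> b s" for t
  proof (induction t)
    case 0
    show ?case by (simp add: j0 b_def)
  next
    case (Suc t)
    have le: "M (retreat (j t)) \<le> M (j t)" using retreat[OF jr0[of t]] by (simp add: is_record_def)
    show ?case
    proof (intro allI impI)
      fix s assume "s \<ge> Suc t"
      hence "M (j t) \<le> b s" "s > t" using Suc by auto
      thus "M (j (Suc t)) \<le> b s" using le unfolding jS by auto
    qed
  qed
  show ?thesis
  proof (rule that[of j])
    show "j 0 = r0" by (rule j0)
    show "M (j (Suc t)) \<le> M (Suc (j t))" for t
      using retreat[OF jr0[of t]] by (simp add: jS is_record_def)
    show "filterlim j at_top sequentially"
      unfolding filterlim_at_top
    proof
      fix K
      obtain R where R: "R \<ge> K" "is_record R" using exists_record[OF M, of K] unfolding is_record_def by blast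
      define C where "C = Max (M ` {..R})"
      have C: "M l \<le> C" if "l \<le> R" for l unfolding C_def using that by (intro Max_ge) auto
      have "\<forall>\<^sub>F s in sequentially. a s \<ge> C" using a by (simp add: filterlim_at_top)
      then obtain T where T: "\<And>s. s \<ge> T \<Longrightarrow> a s \<ge> C" by (auto simp: eventually_sequentially)
      have up: "j (T + i) \<ge> min R i" for i
      proof (induction i)
        case (Suc i)
        show ?case
        proof (cases "j (T + i) \<ge> R")
          case True
          thus ?thesis using ge[of R "T + i" "Suc (T + i)"] R(2) by simp
        next
          case False
          have "M (Suc (j (T + i))) \<le> b s" if "s > T + i" for s
            using C[of "Suc (j (T + i))"] T[of s] False that by (auto simp: b_def)
          thus ?thesis using Suc False by (auto simp: jS)
        qed
      qed simp
      have "j t \<ge> K" if "t \<ge> T + R" for t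
        using ge[of R "T + R" t] up[of R] R that by simp
      thus "\<forall>\<^sub>F t in sequentially. K \<le> j t" unfolding eventually_sequentially by blast
    qed
    have "\<forall>\<^sub>F t in sequentially. a t \<ge> M r0" using a by (simp add: filterlim_at_top)
    thus "\<forall>\<^sub>F t in sequentially. M (j t) \<le> a t"
    proof eventually_elim
      case (elim t)
      thus ?case using inv[of t] by (auto simp: b_def max_def)
    qed
  qed
qed

text \<open>The points whose first \<open>t\<close> iterates visit the prescribed sets form a decreasing sequence of nonempty
compact sets: any target in \<open>K t\<close> can be pulled back step by step.\<close>

lemma orbit_through_compact_sets:
  fixes f :: "complex \<Rightarrow> complex"
  assumes f: "continuous_on UNIV f" and K: "\<And>t. compact (K t)" "\<And>t. K t \<noteq> {}"
    and cov: "\<And>t. K (Suc t) \<subseteq> f ` K t"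
  obtains \<zeta> where "\<And>t. (f ^^ t) \<zeta> \<in> K t"
proof -
  define X where "X = (\<lambda>t. K 0 \<inter> (\<Inter>s\<in>{..t}. (f ^^ s) -` K s))"
  have cf: "continuous_on UNIV (f ^^ s)" for s
  proof (induction s)
    case (Suc s)
    show ?case unfolding funpow.simps(2)
      by (rule continuous_on_compose[OF Suc continuous_on_subset[OF f subset_UNIV]])
  qed (auto simp: id_def)
  have reach: "\<exists>\<zeta>. (\<forall>s\<le>t. (f ^^ s) \<zeta> \<in> K s) \<and> (f ^^ t) \<zeta> = w" if "w \<in> K t" for t w
    using that
  proof (induction t arbitrary: w)
    case (Suc t)
    then obtain x where x: "x \<in> K t" "w = f x" using cov by blast
    from Suc.IH[OF x(1)] obtain \<zeta> where "\<forall>s\<le>t. (f ^^ s) \<zeta> \<in> K s" "(f ^^ t) \<zeta> = x" by blast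
    thus ?case using Suc.prems x by (intro exI[of _ \<zeta>]) (auto simp: le_Suc_eq)
  qed (auto intro: exI)
  have "\<Inter>(range X) \<noteq> {}"
  proof (rule compact_nest)
    fix t
    show "compact (X t)" unfolding X_def
      by (intro compact_Int_closed K closed_INT ballI closed_vimage compact_imp_closed cf)
    obtain w where "w \<in> K t" using K(2) by blast
    from reach[OF this] obtain \<zeta> where "\<forall>s\<le>t. (f ^^ s) \<zeta> \<in> K s" by blast
    thus "X t \<noteq> {}" unfolding X_def by (force intro!: exI[of _ \<zeta>])
  next
    show "X n \<subseteq> X m" if "m \<le> n" for m n using that unfolding X_def by auto
  qed
  then obtain \<zeta> where "\<And>t. \<zeta> \<in> X t" by blast
  thus ?thesis by (intro that[of \<zeta>]) (auto simp: X_def)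
qed

section \<open>Escaping points and the Julia set\<close>

text \<open>A sequence of times at which the orbit of \<open>y\<close> stays bounded would contain a subsequence along which the
iterates either converge at \<open>x\<close> to a finite value or diverge at \<open>y\<close>; neither is possible.\<close>

lemma normal_neighbourhood_escaping:
  assumes U: "normal_family U (range (\<lambda>n. f ^^ n))" and x: "x \<in> U" "x \<in> escaping_set f" and y: "y \<in> U"
  shows "y \<in> escaping_set f"
proof (rule ccontr)
  assume "y \<notin> escaping_set f"
  hence "\<exists>B>0. \<not> (\<forall>\<^sub>F n in sequentially. B \<le> norm ((f ^^ n) y))"
    unfolding escaping_set_def mem_Collect_eq
    using filterlim_at_infinity[of 0 "\<lambda>n. (f ^^ n) y" sequentially] by auto
  then obtain B where "\<not> (\<forall>\<^sub>F n in sequentially. B \<le> norm ((f ^^ n) y))" by blast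
  hence "infinite {n. norm ((f ^^ n) y) < B}"
    unfolding infinite_nat_iff_unbounded_le by (auto simp: eventually_sequentially not_le)
  then obtain r :: "nat \<Rightarrow> nat" where r: "strict_mono r" "\<And>n. norm ((f ^^ r n) y) < B"
    using infinite_enumerate by (metis mem_Collect_eq)
  have "range (\<lambda>n. f ^^ r n) \<subseteq> range (\<lambda>n. f ^^ n)" by auto
  with U obtain s :: "nat \<Rightarrow> nat" where s: "strict_mono s" and
    alt: "(\<exists>h. \<forall>K. compact K \<and> K \<subseteq> U \<longrightarrow> uniform_limit K ((\<lambda>n. f ^^ r n) \<circ> s) h sequentially) \<or>
          (\<forall>K. compact K \<and> K \<subseteq> U \<longrightarrow>
            (\<forall>B. \<forall>\<^sub>F n in sequentially. \<forall>z\<in>K. norm ((f ^^ r (s n)) z) > B))"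
    unfolding normal_family_def by meson
  have xy: "compact {x,y}" "{x,y} \<subseteq> U" using x y by auto
  from alt show False
  proof
    assume "\<exists>h. \<forall>K. compact K \<and> K \<subseteq> U \<longrightarrow> uniform_limit K ((\<lambda>n. f ^^ r n) \<circ> s) h sequentially"
    then obtain h where "uniform_limit {x,y} ((\<lambda>n. f ^^ r n) \<circ> s) h sequentially" using xy by blast
    from tendsto_uniform_limitI[OF this, of x] have "(\<lambda>n. (f ^^ r (s n)) x) \<longlonglongrightarrow> h x" by simp
    moreover have "filterlim (\<lambda>n. (f ^^ r (s n)) x) at_infinity sequentially"
      using filterlim_compose[OF _ filterlim_subseq[OF strict_mono_compose[OF r(1) s]], of "\<lambda>n. (f ^^ n) x"]
        x(2) by (simp add: escaping_set_def)
    ultimately show False using not_tendsto_and_filterlim_at_infinity[of sequentially] by auto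
  next
    assume "\<forall>K. compact K \<and> K \<subseteq> U \<longrightarrow>
            (\<forall>B. \<forall>\<^sub>F n in sequentially. \<forall>z\<in>K. norm ((f ^^ r (s n)) z) > B)"
    hence "\<forall>\<^sub>F n in sequentially. \<forall>z\<in>{x,y}. norm ((f ^^ r (s n)) z) > B" using xy by blast
    from eventually_happens'[OF sequentially_bot this] obtain n where "norm ((f ^^ r (s n)) y) > B" by blast
    thus False using r(2)[of "s n"] by simp
  qed
qed

text \<open>On a connected subset of the Fatou set escape is an all-or-nothing property. This is used to detect
the Julia set: a connected set that contains both an escaping and a non-escaping point must meet it.\<close>

lemma connected_fatou_subset_escaping:
  assumes "connected E" "E \<subseteq> fatou_set f" "x \<in> E" "x \<in> escaping_set f" "y \<in> E"
  shows "y \<in> escaping_set f"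
proof (rule connected_induction_simple[where P = "\<lambda>x. x \<in> escaping_set f", OF assms(1,3,5,4)])
  fix a assume "a \<in> E"
  then obtain U where U: "open U" "a \<in> U" "normal_family U (range (\<lambda>n. f ^^ n))"
    using assms(2) by (auto simp: fatou_set_def)
  show "\<exists>T. openin (top_of_set E) T \<and> a \<in> T \<and> (\<forall>x\<in>T. \<forall>y\<in>T. x \<in> escaping_set f \<longrightarrow> y \<in> escaping_set f)"
    using U \<open>a \<in> E\<close> normal_neighbourhood_escaping[OF U(3)]
    by (intro exI[of _ "E \<inter> U"]) (auto intro: openin_open_Int)
qed

text \<open>Iterates near \<open>f z\<close> are read off from iterates near \<open>z\<close>, shifted by one: a small disc around \<open>z\<close> is
mapped onto an open set by the open mapping theorem, and limits along the disc descend to its image.\<close>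

lemma fatou_set_forward_invariant:
  assumes f: "f holomorphic_on UNIV" "\<not> f constant_on UNIV" and z: "z \<in> fatou_set f"
  shows "f z \<in> fatou_set f"
proof -
  obtain U where U: "open U" "z \<in> U" "normal_family U (range (\<lambda>n. f ^^ n))"
    using z by (auto simp: fatou_set_def)
  obtain r where r: "r > 0" "cball z r \<subseteq> U" using U open_contains_cball by blast
  define Y where "Y = f ` ball z r"
  have cf: "continuous_on UNIV f" by (rule holomorphic_on_imp_continuous_on[OF f(1)])
  have "normal_family Y (range (\<lambda>n. f ^^ n))"
    unfolding normal_family_def
  proof (intro allI impI)
    fix g :: "nat \<Rightarrow> complex \<Rightarrow> complex" assume g: "range g \<subseteq> range (\<lambda>n. f ^^ n)"
    have "range (\<lambda>n. g n \<circ> f) \<subseteq> range (\<lambda>n. f ^^ n)"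
    proof safe
      fix n
      obtain m where "g n = f ^^ m" using g by blast
      hence "g n \<circ> f = f ^^ Suc m" by (simp only: funpow_Suc_right)
      thus "g n \<circ> f \<in> range (\<lambda>n. f ^^ n)" by blast
    qed
    with U(3) obtain s :: "nat \<Rightarrow> nat" where s: "strict_mono s" and
      alt: "(\<exists>h. \<forall>K. compact K \<and> K \<subseteq> U \<longrightarrow> uniform_limit K ((\<lambda>n. g n \<circ> f) \<circ> s) h sequentially) \<or>
          (\<forall>K. compact K \<and> K \<subseteq> U \<longrightarrow>
            (\<forall>B. \<forall>\<^sub>F n in sequentially. \<forall>z\<in>K. norm ((g (s n) \<circ> f) z) > B))"
      unfolding normal_family_def by meson
    have cb: "compact (cball z r)" "cball z r \<subseteq> U" using r by auto
    have pre: "\<exists>x. x \<in> cball z r \<and> f x = w" if "w \<in> Y" for w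
      using that ball_subset_cball[of z r] unfolding Y_def by blast
    show "\<exists>s. strict_mono (s :: nat \<Rightarrow> nat) \<and>
         ((\<exists>h. \<forall>K. compact K \<and> K \<subseteq> Y \<longrightarrow> uniform_limit K (g \<circ> s) h sequentially) \<or>
          (\<forall>K. compact K \<and> K \<subseteq> Y \<longrightarrow>
            (\<forall>B. \<forall>\<^sub>F n in sequentially. \<forall>z\<in>K. norm (g (s n) z) > B)))"
    proof (intro exI[of _ s] conjI s)
      from alt show "(\<exists>h. \<forall>K. compact K \<and> K \<subseteq> Y \<longrightarrow> uniform_limit K (g \<circ> s) h sequentially) \<or>
          (\<forall>K. compact K \<and> K \<subseteq> Y \<longrightarrow> (\<forall>B. \<forall>\<^sub>F n in sequentially. \<forall>z\<in>K. norm (g (s n) z) > B))"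
      proof (rule disj_forward; (intro allI impI)?)
        assume "\<exists>h. \<forall>K. compact K \<and> K \<subseteq> U \<longrightarrow> uniform_limit K ((\<lambda>n. g n \<circ> f) \<circ> s) h sequentially"
        then obtain h where h: "uniform_limit (cball z r) ((\<lambda>n. g n \<circ> f) \<circ> s) h sequentially"
          using cb by blast
        \<comment> \<open>Any choice of preimages transports the uniform limit to \<open>Y\<close>.\<close>
        define e where "e = (\<lambda>w. SOME x. x \<in> cball z r \<and> f x = w)"
        have e: "e w \<in> cball z r" "f (e w) = w" if "w \<in> Y" for w
          using someI_ex[OF pre[OF that]] by (auto simp: e_def)
        have "uniform_limit K (g \<circ> s) (h \<circ> e) sequentially" if "K \<subseteq> Y" for K
          unfolding uniform_limit_iff
        proof (intro allI impI)
          fix \<epsilon> :: real assume "\<epsilon> > 0"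
          with h have "\<forall>\<^sub>F n in sequentially. \<forall>x\<in>cball z r. dist (((\<lambda>n. g n \<circ> f) \<circ> s) n x) (h x) < \<epsilon>"
            unfolding uniform_limit_iff by blast
          thus "\<forall>\<^sub>F n in sequentially. \<forall>w\<in>K. dist ((g \<circ> s) n w) ((h \<circ> e) w) < \<epsilon>"
          proof eventually_elim
            case (elim n)
            show ?case
            proof
              fix w assume "w \<in> K"
              hence "w \<in> Y" using that by blast
              from e[OF this] elim show "dist ((g \<circ> s) n w) ((h \<circ> e) w) < \<epsilon>" by force
            qed
          qed
        qed
        thus "\<exists>h. \<forall>K. compact K \<and> K \<subseteq> Y \<longrightarrow> uniform_limit K (g \<circ> s) h sequentially" by blast
      next
        fix K B
        assume "\<forall>K. compact K \<and> K \<subseteq> U \<longrightarrow>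
            (\<forall>B. \<forall>\<^sub>F n in sequentially. \<forall>z\<in>K. norm ((g (s n) \<circ> f) z) > B)"
          and K: "compact K \<and> K \<subseteq> Y"
        hence "\<forall>\<^sub>F n in sequentially. \<forall>x\<in>cball z r. norm ((g (s n) \<circ> f) x) > B" using cb by blast
        thus "\<forall>\<^sub>F n in sequentially. \<forall>z\<in>K. norm (g (s n) z) > B"
        proof eventually_elim
          case (elim n)
          show ?case
          proof
            fix w assume "w \<in> K"
            then obtain x where "x \<in> cball z r" "f x = w" using pre K by blast
            thus "norm (g (s n) w) > B" using elim by force
          qed
        qed
      qed
    qed
  qed
  moreover have "open Y" unfolding Y_def
    by (rule open_mapping_thm[OF f(1) open_UNIV connected_UNIV open_ball subset_UNIV f(2)])
  moreover have "connected Y" unfolding Y_def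
    by (intro connected_continuous_image continuous_on_subset[OF cf]) auto
  moreover have "f z \<in> Y" using r(1) by (simp add: Y_def)
  ultimately show ?thesis unfolding fatou_set_def by blast
qed

section \<open>Slowly escaping points in the Julia set\<close>

text \<open>The dynamical part, separated from function theory. Over a record \<open>r\<close> the set \<open>E r\<close> covers itself, so it
contains a point with bounded orbit, and following an itinerary that tends to infinity it also contains
an escaping point; being connected, it meets the Julia set. Every other \<open>E n\<close> covers \<open>E (Suc n)\<close>, and
so on up to some record, hence meets the Julia set too. As the complement of the Julia set is forward
invariant, the covering relations persist for the sets \<open>E n \<inter> julia_set f\<close>, and the required orbit is
found inside them along a slow itinerary.\<close>

lemma slow_escaping_julia_point:
  fixes f :: "complex \<Rightarrow> complex" and E :: "nat \<Rightarrow> complex set" and m M a :: "nat \<Rightarrow> real"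
  assumes f: "f holomorphic_on UNIV" "\<not> f constant_on UNIV"
    and E: "\<And>n. compact (E n)" "\<And>n. connected (E n)" "\<And>n. E n \<noteq> {}"
    and mM: "\<And>n x. x \<in> E n \<Longrightarrow> m n \<le> norm x" "\<And>n x. x \<in> E n \<Longrightarrow> norm x \<le> M n"
    and m: "filterlim m at_top sequentially"
    and cover: "\<And>n k. M k \<le> M (Suc n) \<Longrightarrow> E k \<subseteq> f ` E n"
    and a: "filterlim a at_top sequentially"
  obtains \<zeta> j where "\<zeta> \<in> escaping_set f" "\<zeta> \<in> julia_set f" "\<And>t. (f ^^ t) \<zeta> \<in> E (j t)"
    "\<forall>\<^sub>F t in sequentially. norm ((f ^^ t) \<zeta>) \<le> a t"
proof -
  have cf: "continuous_on UNIV f" by (rule holomorphic_on_imp_continuous_on[OF f(1)])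
  have "m n \<le> M n" for n
  proof -
    obtain x where "x \<in> E n" using E(3) by blast
    thus ?thesis using mM[of x n] by linarith
  qed
  hence M: "filterlim M at_top sequentially"
    by (intro filterlim_at_top_mono[OF m]) simp
  have esc: "\<zeta> \<in> escaping_set f"
    if "filterlim j at_top sequentially" "\<And>t. (f ^^ t) \<zeta> \<in> E (j t)" for j :: "nat \<Rightarrow> nat" and \<zeta>
  proof -
    have "filterlim (\<lambda>t. m (j t)) at_top sequentially" by (rule filterlim_compose[OF m that(1)])
    hence "filterlim (\<lambda>t. norm ((f ^^ t) \<zeta>)) at_top sequentially"
      by (rule filterlim_at_top_mono) (use mM(1)[OF that(2)] in simp)
    thus ?thesis unfolding escaping_set_def by (simp add: filterlim_at_infinity_conv_norm_at_top)
  qed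
  have meets_record: "E r \<inter> julia_set f \<noteq> {}" if r: "\<And>l. l \<ge> r \<Longrightarrow> M r \<le> M l" for r
  proof
    assume "E r \<inter> julia_set f = {}"
    hence fat: "E r \<subseteq> fatou_set f" by (auto simp: julia_set_def)
    obtain y where y: "\<And>t. (f ^^ t) y \<in> E r"
      using orbit_through_compact_sets[OF cf, of "\<lambda>_. E r"] E cover[of r r] r[of "Suc r"] by auto
    have "y \<notin> escaping_set f"
    proof
      assume "y \<in> escaping_set f"
      hence "filterlim (\<lambda>t. norm ((f ^^ t) y)) at_top sequentially"
        by (simp add: escaping_set_def filterlim_at_infinity_conv_norm_at_top)
      hence "\<forall>\<^sub>F t in sequentially. norm ((f ^^ t) y) \<ge> M r + 1" by (simp add: filterlim_at_top)
      from eventually_happens'[OF sequentially_bot this] obtain t where "norm ((f ^^ t) y) \<ge> M r + 1" ..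
      thus False using mM(2)[OF y[of t]] by simp
    qed
    obtain j where j: "j 0 = r" "\<And>t. M (j (Suc t)) \<le> M (Suc (j t))" "filterlim j at_top sequentially"
      using slow_itinerary[OF M a r] by metis
    obtain x where x: "\<And>t. (f ^^ t) x \<in> E (j t)"
      using orbit_through_compact_sets[OF cf, of "\<lambda>t. E (j t)"] E cover[OF j(2)] by auto
    have "x \<in> E r" "y \<in> E r" using x[of 0] y[of 0] j(1) by auto
    from connected_fatou_subset_escaping[OF E(2) fat this(1) esc[OF j(3) x] this(2)]
    show False using \<open>y \<notin> escaping_set f\<close> by blast
  qed
  have coverJ: "E k \<inter> julia_set f \<subseteq> f ` (E n \<inter> julia_set f)" if "M k \<le> M (Suc n)" for k n
    using cover[OF that] fatou_set_forward_invariant[OF f] by (force simp: julia_set_def)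
  have meets: "E n \<inter> julia_set f \<noteq> {}" for n
  proof -
    obtain r where r: "r \<ge> n" "\<And>l. l \<ge> r \<Longrightarrow> M r \<le> M l" using exists_record[OF M] by blast
    from r(1) show ?thesis
    proof (induction rule: inc_induct)
      case base
      show ?case by (rule meets_record[OF r(2)])
    next
      case (step n)
      thus ?case using coverJ[of "Suc n" n] by blast
    qed
  qed
  have "closed (julia_set f)"
  proof -
    have "\<forall>z\<in>fatou_set f. \<exists>T. open T \<and> z \<in> T \<and> T \<subseteq> fatou_set f" unfolding fatou_set_def by blast
    hence "open (fatou_set f)" by (subst open_subopen)
    thus ?thesis by (simp add: julia_set_def closed_Compl)
  qed
  hence cJ: "compact (E n \<inter> julia_set f)" for n using E(1) by (simp add: compact_Int_closed)
  obtain r where r: "\<And>l. l \<ge> r \<Longrightarrow> M r \<le> M l" using exists_record[OF M] by blast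
  obtain j where j: "\<And>t. M (j (Suc t)) \<le> M (Suc (j t))" "filterlim j at_top sequentially"
    "\<forall>\<^sub>F t in sequentially. M (j t) \<le> a t"
    using slow_itinerary[OF M a r] by metis
  obtain \<zeta> where \<zeta>: "\<And>t. (f ^^ t) \<zeta> \<in> E (j t) \<inter> julia_set f"
    using orbit_through_compact_sets[OF cf, of "\<lambda>t. E (j t) \<inter> julia_set f"] cJ meets coverJ[OF j(1)] by metis
  show ?thesis
  proof (rule that[of \<zeta> j])
    show "\<zeta> \<in> escaping_set f" using esc[OF j(2)] \<zeta> by blast
    show "\<zeta> \<in> julia_set f" using \<zeta>[of 0] by simp
    show "(f ^^ t) \<zeta> \<in> E (j t)" for t using \<zeta> by blast
    show "\<forall>\<^sub>F t in sequentially. norm ((f ^^ t) \<zeta>) \<le> a t"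
      using j(3)
    proof eventually_elim
      case (elim t)
      thus ?case using mM(2)[of "(f ^^ t) \<zeta>" "j t"] \<zeta>[of t] by auto
    qed
  qed
qed

theorem theorem1p3:
  fixes f :: "complex \<Rightarrow> complex" and D :: "complex set" and a :: "nat \<Rightarrow> real"
  assumes "transcendental_entire f"
    and "direct_tract f D"
    and "bounded_geometry_harmonic_measure f D"
    and "\<forall>n. a n > 0"
    and "filterlim a at_top sequentially"
  shows "\<exists>\<zeta> \<in> escaping_set f \<inter> julia_set f \<inter> closure D. \<exists>N::nat.
           (\<forall>n\<ge>1. (f ^^ n) \<zeta> \<in> closure D) \<and>
           (\<forall>n\<ge>N. norm ((f ^^ n) \<zeta>) \<le> a n)"
proof -
  have hf: "f holomorphic_on UNIV" and nonconst: "\<not> f constant_on UNIV"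
  proof -
    show "f holomorphic_on UNIV" using assms(1) by (simp add: transcendental_entire_def)
    show "\<not> f constant_on UNIV"
    proof
      assume "f constant_on UNIV"
      then obtain c where "\<And>z. f z = c" by (auto simp: constant_on_def)
      hence "\<forall>z. f z = poly [:c:] z" by simp
      thus False using assms(1) unfolding transcendental_entire_def by blast
    qed
  qed
  have cf: "continuous_on X f" for X
    using holomorphic_on_imp_continuous_on[OF hf] continuous_on_subset by blast
  obtain \<Sigma> V z \<sigma> c where quad: "\<And>n. quadrilateral (\<Sigma> n) (V n)" and \<Sigma>D: "\<And>n. \<Sigma> n \<subseteq> D"
    and infty: "filterlim (\<lambda>n. INF w\<in>\<Sigma> n. norm w) at_top sequentially"
    and z: "\<And>n. z n \<in> \<Sigma> n" "\<And>n. norm (f (z n)) > (SUP w\<in>\<Sigma> (Suc n). norm w)"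
    and \<sigma>: "\<And>n. \<sigma> n \<in> components (frontier (\<Sigma> n) \<inter> frontier D)"
    and c: "c > 0" "\<And>n. harmonic_measure (\<Sigma> n) (\<sigma> n) (z n) \<ge> c"
    using assms(3) unfolding bounded_geometry_harmonic_measure_def by metis
  have fr1: "norm (f x) = 1" if "x \<in> frontier D" for x
    using assms(3) that unfolding bounded_geometry_harmonic_measure_def by blast
  have \<sigma>': "connected (\<sigma> n)" "\<sigma> n \<noteq> {}" "\<sigma> n \<subseteq> frontier (\<Sigma> n)" "\<sigma> n \<subseteq> frontier D" for n
    using in_components_connected[OF \<sigma>] in_components_nonempty[OF \<sigma>] in_components_subset[OF \<sigma>] by auto
  have gt1: "norm (f x) > 1" if "x \<in> D" for x
  proof -
    obtain R where R: "\<And>z. z \<in> frontier D \<Longrightarrow> norm (f z) = R" "\<And>z. z \<in> D \<Longrightarrow> norm (f z) > R"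
      using assms(2) unfolding direct_tract_def by blast
    obtain y where "y \<in> frontier D" using \<sigma>'(2,4)[of 0] by blast
    hence "R = 1" using R(1) fr1 by metis
    thus ?thesis using R(2)[OF that] by simp
  qed
  have jd: "jordan_domain (\<Sigma> n)" for n using quad by (simp add: quadrilateral_def)
  obtain R where R: "R > 1" and annulus:
    "\<And>(f :: complex \<Rightarrow> complex) S \<sigma> z w. \<lbrakk>jordan_domain S; f holomorphic_on S; continuous_on (closure S) f;
       \<And>x. x \<in> S \<Longrightarrow> norm (f x) > 1; \<sigma> \<subseteq> frontier S; connected \<sigma>; \<sigma> \<noteq> {};
       \<And>x. x \<in> \<sigma> \<Longrightarrow> norm (f x) = 1; z \<in> S; harmonic_measure S \<sigma> z \<ge> c;
       R \<le> norm w; norm w \<le> norm (f z)\<rbrakk> \<Longrightarrow> w \<in> f ` S"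
    using image_covers_annulus[OF c(1)] by metis
  have cov: "w \<in> f ` \<Sigma> n" if "R \<le> norm w" "norm w \<le> norm (f (z n))" for w n
  proof (rule annulus[OF jd _ cf _ \<sigma>'(3,1,2) _ z(1) c(2) that])
    show "f holomorphic_on \<Sigma> n" using hf holomorphic_on_subset by blast
    show "norm (f x) > 1" if "x \<in> \<Sigma> n" for x using gt1 \<Sigma>D that by blast
    show "norm (f x) = 1" if "x \<in> \<sigma> n" for x using fr1 \<sigma>'(4) that by blast
  qed
  \<comment> \<open>Discard the quadrilaterals that are not contained in the region of validity of the
      covering theorem.\<close>
  have "\<forall>\<^sub>F n in sequentially. (INF w\<in>\<Sigma> n. norm w) \<ge> R" using infty by (simp add: filterlim_at_top)
  then obtain N where N: "\<And>n. n \<ge> N \<Longrightarrow> (INF w\<in>\<Sigma> n. norm w) \<ge> R" by (auto simp: eventually_sequentially)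
  define m where "m = (\<lambda>n. INF w\<in>\<Sigma> (n + N). norm w)"
  define M where "M = (\<lambda>n. SUP w\<in>\<Sigma> (n + N). norm w)"
  define E where "E = (\<lambda>n. closure (\<Sigma> (n + N)))"
  have bdd: "bounded (\<Sigma> n)" for n by (rule jordan_domainD(3)[OF jd])
  have lo: "m n \<le> norm x" if "x \<in> \<Sigma> (n + N)" for n x
    unfolding m_def by (rule cINF_lower) (use that in \<open>auto intro: bdd_belowI[of _ 0]\<close>)
  have up: "norm x \<le> M n" if "x \<in> \<Sigma> (n + N)" for n x
    unfolding M_def by (rule cSUP_upper[OF that]) (use bdd in \<open>auto simp: bounded_imp_bdd_above bounded_norm_comp\<close>)
  have lo': "m n \<le> norm x" if "x \<in> E n" for n x
    by (rule continuous_ge_on_closure[of "\<Sigma> (n + N)" norm])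
       (use that lo in \<open>auto simp: E_def intro: continuous_intros\<close>)
  have up': "norm x \<le> M n" if "x \<in> E n" for n x
    by (rule continuous_le_on_closure[of "\<Sigma> (n + N)" norm])
       (use that up in \<open>auto simp: E_def intro: continuous_intros\<close>)
  obtain \<zeta> j where \<zeta>: "\<zeta> \<in> escaping_set f" "\<zeta> \<in> julia_set f" "\<And>t. (f ^^ t) \<zeta> \<in> E (j t)"
    "\<forall>\<^sub>F t in sequentially. norm ((f ^^ t) \<zeta>) \<le> a t"
  proof (rule slow_escaping_julia_point[OF hf nonconst _ _ _ lo' up' _ _ assms(5)])
    show cE: "compact (E n)" for n unfolding E_def using bdd by (simp add: compact_closure)
    show "connected (E n)" for n
      unfolding E_def by (rule connected_imp_connected_closure[OF jordan_domainD(2)[OF jd]])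
    show "E n \<noteq> {}" for n using z(1) by (auto simp: E_def)
    show "filterlim m at_top sequentially"
      unfolding m_def by (rule filterlim_compose[OF infty filterlim_add_const_nat_at_top])
    fix n k assume le: "M k \<le> M (Suc n)"
    have "\<Sigma> (k + N) \<subseteq> f ` E n"
    proof
      fix w assume w: "w \<in> \<Sigma> (k + N)"
      have "norm w \<le> norm (f (z (n + N)))"
        using up[OF w] le z(2)[of "n + N"] by (simp add: M_def)
      moreover have "R \<le> norm w" using lo[OF w] N[of "k + N"] by (simp add: m_def)
      ultimately have "w \<in> f ` \<Sigma> (n + N)" by (intro cov)
      thus "w \<in> f ` E n" using closure_subset unfolding E_def by blast
    qed
    moreover have "closed (f ` E n)" by (intro compact_imp_closed compact_continuous_image cf cE)
    ultimately show "E k \<subseteq> f ` E n" unfolding E_def by (rule closure_minimal)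
  next
    fix \<zeta> and j :: "nat \<Rightarrow> nat"
    assume "\<zeta> \<in> escaping_set f" "\<zeta> \<in> julia_set f" "\<And>t. (f ^^ t) \<zeta> \<in> E (j t)"
      "\<forall>\<^sub>F t in sequentially. norm ((f ^^ t) \<zeta>) \<le> a t"
    thus thesis by (rule that)
  qed
  have ED: "E n \<subseteq> closure D" for n unfolding E_def by (intro closure_mono \<Sigma>D)
  obtain N' where "\<And>n. n \<ge> N' \<Longrightarrow> norm ((f ^^ n) \<zeta>) \<le> a n"
    using \<zeta>(4) by (auto simp: eventually_sequentially)
  moreover have "(f ^^ n) \<zeta> \<in> closure D" for n using \<zeta>(3)[of n] ED by blast
  moreover from this[of 0] have "\<zeta> \<in> closure D" by simp
  ultimately show ?thesis using \<zeta>(1,2) by blast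
qed

end
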